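(* Let $\alpha,\beta>-1$, let $g\in H(\mathbb{D})$, and let $0<p<q<\infty$. Then $S_g:D_\alpha^p\to D_\beta^q$ is bounded if and only if $|g(z)|=O\left((1-|z|^2)^{\frac{2+\alpha}{p}-\frac{2+\beta}{q}}\right)$ as $|z|\to1^-$.
   Context: $\mathbb{D}$ is the open unit disk in $\mathbb{C}$, $H(\mathbb{D})$ is the space of analytic functions on $\mathbb{D}$, and $dA(z)=\frac1\pi\,dx\,dy$ is normalized area measure. For $0<p<\infty$ and $\alpha>-1$, the weighted Dirichlet space $D_\alpha^p$ is the set of $f\in H(\mathbb{D})$ with $\|f\|_{D_\alpha^p}=\left(|f(0)|^p+\int_{\mathbb{D}}|f'(z)|^p(1-|z|^2)^\alpha\,dA(z)\right)^{1/p}<\infty$. (For $p<1$ this is only a quasi-norm.) For $g\in H(\mathbb{D})$, the operator $S_g$ is $(S_gf)(z)=\int_0^z f'(\omega)g(\omega)\,d\omega$, $f\in H(\mathbb{D})$. An operator $T:D_\alpha^p\to D_\beta^q$ is bounded if it maps $D_\alpha^p$ into $D_\beta^q$ and there is a constant $C$ with $\|Tf\|_{D_\beta^q}\le C\|f\|_{D_\alpha^p}$ for all $f\in D_\alpha^p$. *)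

theory Defs
  imports "HOL-Complex_Analysis.Complex_Analysis" "HOL-Library.Landau_Symbols"
begin

(* The unit disk is ball 0 1.  An element of H(D) is represented by a total function
   complex => complex that is holomorphic on the disk; every notion below depends only
   on its values in the disk. *)

definition area_measure :: "complex measure" where
  "area_measure = density lborel (\<lambda>_. ennreal (1 / pi))"

definition dirichlet_integrand :: "real \<Rightarrow> real \<Rightarrow> (complex \<Rightarrow> complex) \<Rightarrow> complex \<Rightarrow> real" where
  "dirichlet_integrand p \<alpha> f z = norm (deriv f z) powr p * (1 - (norm z)\<^sup>2) powr \<alpha>"

(* The integrand is nonnegative and continuous on the disk, so integrability is the same
   as finiteness of the integral. *)
definition dirichlet_space :: "real \<Rightarrow> real \<Rightarrow> (complex \<Rightarrow> complex) set" where
  "dirichlet_space p \<alpha> =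
     {f. f holomorphic_on ball 0 1 \<and>
         set_integrable area_measure (ball 0 1) (dirichlet_integrand p \<alpha> f)}"

(* Only meaningful for members of dirichlet_space p alpha: a divergent Lebesgue integral
   has the default value 0. *)
definition dirichlet_norm :: "real \<Rightarrow> real \<Rightarrow> (complex \<Rightarrow> complex) \<Rightarrow> real" where
  "dirichlet_norm p \<alpha> f =
     (norm (f 0) powr p + (LINT z:ball 0 1|area_measure. dirichlet_integrand p \<alpha> f z)) powr (1 / p)"

(* For f, g in H(D) and z in D the integral is path-independent in D. *)
definition S_op :: "(complex \<Rightarrow> complex) \<Rightarrow> (complex \<Rightarrow> complex) \<Rightarrow> complex \<Rightarrow> complex" where
  "S_op g f z = contour_integral (linepath 0 z) (\<lambda>w. deriv f w * g w)"

definition bounded_dirichlet_op ::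
  "real \<Rightarrow> real \<Rightarrow> real \<Rightarrow> real \<Rightarrow> ((complex \<Rightarrow> complex) \<Rightarrow> complex \<Rightarrow> complex) \<Rightarrow> bool" where
  "bounded_dirichlet_op p \<alpha> q \<beta> T \<longleftrightarrow>
     T ` dirichlet_space p \<alpha> \<subseteq> dirichlet_space q \<beta> \<and>
     (\<exists>C. \<forall>f\<in>dirichlet_space p \<alpha>. dirichlet_norm q \<beta> (T f) \<le> C * dirichlet_norm p \<alpha> f)"

(* The limit |z| -> 1-, uniformly in the argument of z. *)
definition to_unit_circle :: "complex filter" where
  "to_unit_circle = filtercomap norm (at_left 1)"

end

theory Submission
  imports Defs
begin

text \<open>
  Since \<open>(S_op g f)' = f' g\<close>, boundedness says that multiplication by \<open>g\<close> maps the weighted Bergman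
  space \<open>A^p_\<alpha>\<close> boundedly into \<open>A^q_\<beta>\<close>.  Everything rests on the point estimate
  \<open>|h(z)|^p (1 - |z|^2)^(2 + \<alpha>) \<le> C \<parallel>h\<parallel>^p\<close>, obtained by averaging \<open>|h|^p\<close> over a disc of radius
  \<open>(1 - |z|) / 2\<close>.  If \<open>g\<close> satisfies the growth condition, write \<open>|h|^q = |h|^p |h|^(q - p)\<close> and apply
  the point estimate to the second factor.  Conversely, test on
  \<open>h_a = ((1 - |a|^2) / (1 - cnj a z)^2)^((2 + \<alpha>) / p)\<close>, whose norm does not depend on \<open>a\<close> by the
  change of variables \<open>w = (z - a) / (1 - cnj a z)\<close>, and apply the point estimate for
  \<open>A^q_\<beta>\<close> to \<open>h_a g\<close> at the point \<open>a\<close>.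
\<close>

section \<open>Conformal change of variables\<close>

text \<open>The point estimate is wanted for all p > 0, and for p < 1 the function x^p is not
  convex, so Jensen's inequality cannot lift the mean value inequality from |h| to |h|^p.
  Subharmonicity of |h|^p is bypassed: a constant depending only on p is good enough, and it is
  deduced from the inequality for |h| by a different argument on each side of p = 1.

  The radius (1 - |z|) / 2 is chosen because the weight is comparable to a constant on that disc, so
  it can be moved under the integral.

  The test function is a power of the derivative of a disc automorphism: h_a = (phi_a')^((2 +
  \<alpha>) / p) with phi_a(z) = (z - a) / (1 - cnj a z). At the point a it attains the point
  estimate up to a constant, since |h_a(a)|^p (1 - |a|^2)^(2 + \<alpha>) = 1 while its norm is
  fixed. This is why the necessary and the sufficient exponent agree.

  Integrals over the complex plane pass through \<open>real^2\<close> because the conformal change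
  of variables is derived from the one for maps of R^n.\<close>

definition vec_complex :: "real^2 \<Rightarrow> complex" where
  "vec_complex v = Complex (vec_nth v 1) (vec_nth v 2)"

definition complex_vec :: "complex \<Rightarrow> real^2" where
  "complex_vec z = (\<chi> i. if i = 1 then Re z else Im z)"

lemma vec_complex_inverse [simp]: "complex_vec (vec_complex v) = v"
  by (simp add: vec_complex_def complex_vec_def vec_eq_iff forall_2)

lemma complex_vec_inverse [simp]: "vec_complex (complex_vec z) = z"
  by (simp add: vec_complex_def complex_vec_def)

lemma linear_vec_complex: "linear vec_complex"
  by (rule linearI) (auto simp: vec_complex_def complex_eq_iff)

lemma linear_complex_vec: "linear complex_vec"
  by (rule linearI) (auto simp: complex_vec_def vec_eq_iff)

lemma continuous_on_vec_complex [continuous_intros]: "continuous_on S vec_complex"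
  by (simp add: linear_continuous_on linear_conv_bounded_linear[symmetric] linear_vec_complex)

lemma vec_complex_image: "complex_vec ` T = vec_complex -` T"
  by (auto simp: image_iff) (metis vec_complex_inverse)

text \<open>Lebesgue measure is determined by the volumes of boxes, and passing to coordinates maps
  boxes to boxes with the same side lengths.\<close>

lemma distr_vec_complex: "distr lborel borel vec_complex = lborel"
proof (rule lborel_eqI[symmetric])
  fix l u :: complex
  assume le: "\<And>b. b \<in> Basis \<Longrightarrow> l \<bullet> b \<le> u \<bullet> b"
  have [measurable]: "vec_complex \<in> borel_measurable borel"
    by (rule borel_measurable_continuous_onI) (rule continuous_on_vec_complex)
  have "vec_complex -` box l u = box (complex_vec l) (complex_vec u)"
    by (auto simp: vec_complex_def complex_vec_def mem_box_cart in_box_complex_iff forall_2)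
  moreover have "Re l \<le> Re u" "Im l \<le> Im u"
    using le[of 1] le[of \<i>] by (auto simp: Basis_complex_def)
  moreover have "(\<Prod>b\<in>Basis. (complex_vec u - complex_vec l) \<bullet> b) = (\<Prod>b\<in>Basis. (u - l) \<bullet> b)"
  proof -
    have "axis 1 1 \<noteq> (axis 2 1 :: real^2)"
      by (simp add: axis_eq_axis)
    then show ?thesis
      by (simp add: Basis_vec_def UNIV_2 Basis_complex_def inner_axis complex_vec_def cart_eq_inner_axis[symmetric])
  qed
  moreover have "emeasure (lborel :: (real^2) measure) (box (complex_vec l) (complex_vec u)) =
      (\<Prod>b\<in>Basis. (complex_vec u - complex_vec l) \<bullet> b)"
    using calculation(2,3)
    by (intro emeasure_lborel_box)
      (auto simp: Basis_vec_def UNIV_2 inner_axis complex_vec_def cart_eq_inner_axis[symmetric])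
  ultimately show "emeasure (distr lborel borel vec_complex) (box l u) = (\<Prod>b\<in>Basis. (u - l) \<bullet> b)"
    by (simp add: emeasure_distr)
qed simp

text \<open>The change of variables is phrased for vector-valued integrands, so a real
  \<open>F\<close> travels as a vector in \<open>real^1\<close>. Continuity on an open set gives
  Borel measurability, by which integrals for the completed measure and for \<open>lborel\<close>
  agree.\<close>

lemma set_integral_vec_complex:
  fixes F :: "complex \<Rightarrow> real"
  assumes T: "open T" and F: "continuous_on T F"
  shows "(\<lambda>v. vec (F (vec_complex v)) :: real^1) absolutely_integrable_on (vec_complex -` T) \<longleftrightarrow>
           set_integrable lborel T F" (is ?th1)
    and "set_integrable lborel T F \<Longrightarrow> integral (vec_complex -` T) (\<lambda>v. vec (F (vec_complex v)) :: real^1) =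
           vec (LINT z:T|lborel. F z)"
proof -
  have mv [measurable]: "vec_complex \<in> borel_measurable borel"
    by (rule borel_measurable_continuous_onI) (rule continuous_on_vec_complex)
  let ?H = "\<lambda>z. indicator T z *\<^sub>R F z"
  have mF: "?H \<in> borel_measurable borel"
    using borel_measurable_continuous_on_indicator[OF _ F] T by simp
  have mFv: "(\<lambda>v. ?H (vec_complex v)) \<in> borel_measurable lborel"
    using measurable_compose[OF mv mF] by simp
  have mv': "vec_complex \<in> measurable lborel borel"
    using mv by simp
  have ind: "indicator (vec_complex -` T) v *\<^sub>R F (vec_complex v) =
      (\<lambda>z. indicator T z *\<^sub>R F z) (vec_complex v)" for v
    by (simp add: indicator_def)
  have i1: "(F \<circ> vec_complex) absolutely_integrable_on (vec_complex -` T) \<longleftrightarrow> set_integrable lborel T F"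
    unfolding set_integrable_def o_def ind
    using integrable_completion[OF mFv] integrable_distr_eq[OF mv' mF]
    by (simp add: distr_vec_complex)
  then show th1: ?th1
    by (simp add: absolutely_integrable_on_1_iff o_def)
  assume int: "set_integrable lborel T F"
  have "integral (vec_complex -` T) (F \<circ> vec_complex) = (LINT v:vec_complex -` T|lebesgue. (F \<circ> vec_complex) v)"
    using set_lebesgue_integral_eq_integral(2)[of "vec_complex -` T" "F \<circ> vec_complex"] i1 int by simp
  also have "\<dots> = (LINT z:T|lborel. F z)"
    unfolding set_lebesgue_integral_def o_def ind
    using integral_completion[OF mFv] integral_distr[OF mv' mF]
    by (simp add: distr_vec_complex)
  finally have eq: "integral (vec_complex -` T) (F \<circ> vec_complex) = (LINT z:T|lborel. F z)" .
  have "vec_nth (integral (vec_complex -` T) (\<lambda>v. vec (F (vec_complex v)) :: real^1)) 1 = (LINT z:T|lborel. F z)"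
    using integral_component_eq_cart[OF set_lebesgue_integral_eq_integral(1)[OF th1[THEN iffD2, OF int]], of 1] eq
    unfolding vec_component o_def by metis
  moreover have "x = vec c \<longleftrightarrow> vec_nth x 1 = c" for x :: "real^1" and c
  proof
    assume *: "vec_nth x 1 = c"
    show "x = vec c"
    proof (rule vec_eq_iff[THEN iffD2], rule allI)
      fix i :: 1
      have "i = 1"
        by (rule num1_eq1)
      then show "vec_nth x i = vec_nth (vec c) i"
        using * by (simp only: vec_component)
    qed
  qed (simp only: vec_component)
  ultimately show "integral (vec_complex -` T) (\<lambda>v. vec (F (vec_complex v)) :: real^1) =
           vec (LINT z:T|lborel. F z)"
    by blast
qed

text \<open>The real derivative of a holomorphic map is multiplication by the complex number c =
  \<open>deriv \<phi> z\<close>, whose determinant is |c|^2.\<close>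

lemma conformal_change_of_variables:
  fixes F :: "complex \<Rightarrow> real" and \<phi> :: "complex \<Rightarrow> complex"
  assumes S: "open S" and hol: "\<phi> holomorphic_on S" and inj: "inj_on \<phi> S"
    and F: "continuous_on (\<phi> ` S) F" and int: "set_integrable lborel (\<phi> ` S) F"
  shows "set_integrable lborel S (\<lambda>z. (norm (deriv \<phi> z))\<^sup>2 * F (\<phi> z))"
    and "(LINT z:S|lborel. (norm (deriv \<phi> z))\<^sup>2 * F (\<phi> z)) = (LINT w:\<phi> ` S|lborel. F w)"
proof -
  let ?G = "\<lambda>z. (norm (deriv \<phi> z))\<^sup>2 * F (\<phi> z)"
  have oT: "open (\<phi> ` S)"
    using open_mapping_thm3[OF hol S inj] .
  have cG: "continuous_on S ?G"
  proof -
    have "continuous_on S (deriv \<phi>)" "continuous_on S \<phi>"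
      using hol S by (auto intro!: holomorphic_on_imp_continuous_on holomorphic_deriv)
    moreover from this have "continuous_on S (\<lambda>z. F (\<phi> z))"
      using continuous_on_compose2[OF F] by blast
    ultimately show ?thesis
      by (intro continuous_on_mult continuous_on_power continuous_on_norm)
  qed
  define g where "g = complex_vec \<circ> \<phi> \<circ> vec_complex"
  define g' where "g' = (\<lambda>x. complex_vec \<circ> (\<lambda>h. deriv \<phi> (vec_complex x) * h) \<circ> vec_complex)"
  have S': "vec_complex -` S \<in> sets lebesgue"
    using sets_completionI_sets[of "vec_complex -` S" lborel]
      borel_open[OF open_vimage[OF S continuous_on_vec_complex]] by simp
  have der: "(g has_derivative g' x) (at x within vec_complex -` S)" if "x \<in> vec_complex -` S" for x
  proof -
    have "(\<phi> has_field_derivative deriv \<phi> (vec_complex x)) (at (vec_complex x))"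
      using that S hol holomorphic_derivI by blast
    then have d: "(\<phi> has_derivative (\<lambda>h. deriv \<phi> (vec_complex x) * h)) (at (vec_complex x))"
      by (simp add: has_field_derivative_def)
    have "((complex_vec \<circ> \<phi> \<circ> vec_complex) has_derivative g' x) (at x)"
      unfolding g'_def
      by (intro diff_chain_at linear_imp_has_derivative linear_vec_complex linear_complex_vec)
        (use d in \<open>simp_all add: o_def\<close>)
    then show ?thesis
      unfolding g_def by (rule has_derivative_at_withinI)
  qed
  have inj': "inj_on g (vec_complex -` S)"
  proof (rule inj_onI)
    fix x y
    assume xy: "x \<in> vec_complex -` S" "y \<in> vec_complex -` S" "g x = g y"
    have "\<phi> (vec_complex x) = \<phi> (vec_complex y)"
      using arg_cong[OF xy(3), of vec_complex] by (simp add: g_def)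
    then have "vec_complex x = vec_complex y"
      using inj xy by (auto dest: inj_onD)
    then show "x = y"
      using vec_complex_inverse by metis
  qed
  have img: "g ` (vec_complex -` S) = vec_complex -` (\<phi> ` S)"
    unfolding g_def vec_complex_image[symmetric] by (simp add: image_comp o_def image_image)
  \<comment> \<open>Multiplication by c has rows (Re c, - Im c) and (Im c, Re c).\<close>
  have det: "\<bar>det (matrix (g' x))\<bar> = (norm (deriv \<phi> (vec_complex x)))\<^sup>2" for x
  proof -
    have "det (matrix (g' x)) = (Re (deriv \<phi> (vec_complex x)))\<^sup>2 + (Im (deriv \<phi> (vec_complex x)))\<^sup>2"
      by (simp add: det_2 matrix_def g'_def complex_vec_def vec_complex_def axis_def power2_eq_square)
    then show ?thesis
      by (simp add: cmod_power2)
  qed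
  have *: "\<bar>det (matrix (g' x))\<bar> *\<^sub>R (vec (F (vec_complex (g x))) :: real^1) = vec (?G (vec_complex x))" for x
    unfolding det by (simp add: g_def vec_eq_iff vec_component del: forall_1)
  have "(\<lambda>v. vec (F (vec_complex v)) :: real^1) absolutely_integrable_on (g ` (vec_complex -` S)) \<and>
     integral (g ` (vec_complex -` S)) (\<lambda>v. vec (F (vec_complex v)) :: real^1) = vec (LINT w:\<phi> ` S|lborel. F w)"
    unfolding img using set_integral_vec_complex[OF oT F] int by simp
  then have G: "(\<lambda>v. vec (?G (vec_complex v)) :: real^1) absolutely_integrable_on (vec_complex -` S) \<and>
     integral (vec_complex -` S) (\<lambda>v. vec (?G (vec_complex v)) :: real^1) = vec (LINT w:\<phi> ` S|lborel. F w)"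
    using has_absolute_integral_change_of_variables[OF S' der inj', of "\<lambda>v. vec (F (vec_complex v)) :: real^1"]
    unfolding * by blast
  then show i: "set_integrable lborel S ?G"
    by (rule set_integral_vec_complex(1)[OF S cG, THEN iffD1, OF conjunct1])
  show "(LINT z:S|lborel. ?G z) = (LINT w:\<phi> ` S|lborel. F w)"
    using set_integral_vec_complex(2)[OF S cG i, symmetric] conjunct2[OF G]
    by (simp only: vec_inj)
qed

section \<open>Averages over discs\<close>

lemma norm_le_circle_average:
  assumes S: "open S" and hol: "k holomorphic_on S" and sub: "cball 0 1 \<subseteq> S"
  shows "norm (k 0) \<le> integral {0..1} (\<lambda>t. norm (k (exp (2 * of_real pi * \<i> * of_real t))))"
proof -
  let ?e = "\<lambda>t::real. exp (2 * of_real pi * \<i> * of_real t)"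
  have "((\<lambda>u. k u / (u - 0)) has_contour_integral (2 * of_real pi * \<i> * k 0)) (circlepath 0 1)"
    using holomorphic_on_subset[OF hol sub] by (rule Cauchy_integral_circlepath_simple) simp
  then have "((\<lambda>t. k (?e t) / ?e t * (2 * of_real pi * \<i> * ?e t)) has_integral (2 * of_real pi * \<i> * k 0)) {0..1}"
    unfolding has_contour_integral_def
    by (rule has_integral_eq[rotated])
      (subst vector_derivative_circlepath01, simp, simp, simp add: circlepath)
  \<comment> \<open>The Cauchy kernel 1 / u cancels the factor u in the velocity of the circle,
    leaving a plain average in t.\<close>
  then have "((\<lambda>t. 2 * of_real pi * \<i> * k (?e t)) has_integral (2 * of_real pi * \<i> * k 0)) {0..1}"
    by (rule has_integral_eq[rotated]) simp
  then have *: "((\<lambda>t. k (?e t)) has_integral k 0) {0..1}"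
    by (subst (asm) has_integral_mult_right_iff) auto
  have "continuous_on {0..1} (\<lambda>t. k (?e t))"
    by (rule continuous_on_compose2[OF holomorphic_on_imp_continuous_on[OF hol]])
      (use sub in \<open>auto intro!: continuous_intros simp: subset_iff\<close>)
  then have "(\<lambda>t. norm (k (?e t))) integrable_on {0..1}"
    by (intro integrable_continuous_interval continuous_on_norm)
  then have "norm (integral {0..1} (\<lambda>t. k (?e t))) \<le> integral {0..1} (\<lambda>t. norm (k (?e t)))"
    using * by (intro integral_norm_bound_integral) auto
  with * show ?thesis
    by (simp add: integral_unique)
qed

lemma set_integrable_ball_continuous:
  fixes F :: "complex \<Rightarrow> real"
  assumes "continuous_on (cball a r) F"
  shows "set_integrable lborel (ball a r) F"
proof -
  have "set_integrable lborel (cball a r) F"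
    unfolding set_integrable_def by (rule borel_integrable_compact[OF compact_cball assms])
  then show ?thesis
    by (rule set_integrable_subset) auto
qed

text \<open>Rotations replace polar coordinates. For each w in the unit disc, |h(a)| is at most the
  average over t of |h(a + r e^(2 pi i t) w)|. Integrate over w and exchange the integrals: for each
  fixed t the map in w is a similarity onto \<open>ball a r\<close>, so the inner integral does not
  depend on t.\<close>

lemma norm_le_disc_average:
  assumes S: "open S" and hol: "h holomorphic_on S" and r: "r > 0" and sub: "cball a r \<subseteq> S"
  shows "norm (h a) * (pi * r\<^sup>2) \<le> (LINT w:ball a r|lborel. norm (h w))"
proof -
  let ?e = "\<lambda>t::real. exp (2 * of_real pi * \<i> * of_real t)"
  let ?D = "ball (0::complex) 1"
  define I where "I = (LINT w:ball a r|lborel. norm (h w))"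
  define H where "H = (\<lambda>(w,t). indicator (?D \<times> {0..1}) (w,t) *\<^sub>R norm (h (a + of_real r * ?e t * w)))"
  have inS: "a + of_real r * ?e t * w \<in> S" if "norm w \<le> 1" for t w
    using that r sub by (auto simp: subset_iff dist_norm norm_mult mult_left_le)
  have ch: "continuous_on S h"
    using hol by (rule holomorphic_on_imp_continuous_on)
  have "H = (\<lambda>p. indicator (?D \<times> {0..1}) p *\<^sub>R norm (h (a + of_real r * ?e (snd p) * fst p)))"
    by (auto simp: H_def fun_eq_iff)
  also have "\<dots> \<in> borel_measurable borel"
    using inS
    by (intro borel_measurable_continuous_on_indicator continuous_on_norm continuous_on_compose2[OF ch])
      (auto intro!: continuous_intros borel_Times)
  finally have mH: "H \<in> borel_measurable (lborel \<Otimes>\<^sub>M lborel)"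
    by (simp add: lborel_prod)
  then have mH': "(\<lambda>(w,t). ennreal (H (w,t))) \<in> borel_measurable (lborel \<Otimes>\<^sub>M lborel)"
    by simp
  have "ennreal (norm (h a) * pi) = (\<integral>\<^sup>+w\<in>?D. ennreal (norm (h a)) \<partial>lborel)"
    by (simp add: nn_integral_cmult_indicator emeasure_ball unit_ball_vol_2 ennreal_mult)
  also have "\<dots> \<le> (\<integral>\<^sup>+w. (\<integral>\<^sup>+t. ennreal (H (w,t)) \<partial>lborel) \<partial>lborel)"
  proof (rule nn_integral_mono)
    fix w :: complex
    show "ennreal (norm (h a)) * indicator ?D w \<le> (\<integral>\<^sup>+t. ennreal (H (w,t)) \<partial>lborel)"
    proof (cases "w \<in> ?D")
      case True
      \<comment> \<open>As u runs over the unit circle, the argument of \<open>h\<close> runs over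
        the circle about \<open>a\<close> of radius r |w|.\<close>
      define k where "k = (\<lambda>u. h (a + of_real r * u * w))"
      have o: "open ((\<lambda>u. a + of_real r * u * w) -` S)"
        by (intro open_vimage S continuous_intros)
      have hk: "k holomorphic_on ((\<lambda>u. a + of_real r * u * w) -` S)"
        unfolding k_def
        by (intro holomorphic_on_compose_gen[OF _ hol, unfolded o_def] holomorphic_intros) auto
      have sk: "cball 0 1 \<subseteq> (\<lambda>u. a + of_real r * u * w) -` S"
        using True r sub by (auto simp: subset_iff dist_norm norm_mult mult_le_one mult_left_le mult.assoc)
      have ck: "continuous_on {0..1} (\<lambda>t. norm (k (?e t)))"
        by (intro continuous_on_norm continuous_on_compose2[OF holomorphic_on_imp_continuous_on[OF hk]])
           (use sk in \<open>auto intro!: continuous_intros simp: subset_iff\<close>)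
      have le: "norm (h a) \<le> integral {0..1} (\<lambda>t. norm (k (?e t)))"
        using norm_le_circle_average[OF o hk sk] by (simp add: k_def)
      have "((\<lambda>t. norm (k (?e t))) has_integral integral {0..1} (\<lambda>t. norm (k (?e t)))) {0..1}"
        by (intro integrable_integral integrable_continuous_interval ck)
      moreover have ind: "indicator {0..1} t *\<^sub>R norm (k (?e t)) = (if t \<in> {0..1} then norm (k (?e t)) else 0)" for t
        by simp
      ultimately have "((\<lambda>t. indicator {0..1} t *\<^sub>R norm (k (?e t))) has_integral
          integral {0..1} (\<lambda>t. norm (k (?e t)))) UNIV"
        unfolding ind has_integral_restrict_UNIV by blast
      then have "(\<integral>\<^sup>+t. indicator {0..1} t *\<^sub>R norm (k (?e t)) \<partial>lborel) = ennreal (integral {0..1} (\<lambda>t. norm (k (?e t))))"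
        using borel_measurable_continuous_on_indicator[OF _ ck]
        by (intro nn_integral_has_integral_lborel) auto
      then have "ennreal (integral {0..1} (\<lambda>t. norm (k (?e t)))) = (\<integral>\<^sup>+t. ennreal (H (w,t)) \<partial>lborel)"
        using True by (auto simp: H_def k_def indicator_def intro!: nn_integral_cong)
      then show ?thesis
        using True ennreal_leI[OF le] by simp
    qed simp
  qed
  also have "\<dots> = (\<integral>\<^sup>+t. (\<integral>\<^sup>+w. ennreal (H (w,t)) \<partial>lborel) \<partial>lborel)"
    by (rule lborel_pair.Fubini'[OF mH', symmetric])
  also have "\<dots> = (\<integral>\<^sup>+t\<in>{0..1}. ennreal (I / r\<^sup>2) \<partial>(lborel::real measure))"
  proof (rule nn_integral_cong)
    fix t :: real
    show "(\<integral>\<^sup>+w. ennreal (H (w,t)) \<partial>lborel) = ennreal (I / r\<^sup>2) * indicator {0..1} t"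
    proof (cases "t \<in> {0..1}")
      case True
      define \<phi> where "\<phi> = (\<lambda>w. a + of_real r * ?e t * w)"
      have nz: "of_real r * ?e t \<noteq> 0"
        using r by simp
      have inj: "inj_on \<phi> ?D"
        using nz by (auto simp: \<phi>_def inj_on_def)
      have img: "\<phi> ` ?D = ball a r"
      proof -
        have "\<phi> = (\<lambda>w. a + w) \<circ> (\<lambda>w. (of_real r * ?e t) * w)"
          by (simp add: \<phi>_def o_def)
        then have "\<phi> ` ?D = (\<lambda>w. a + w) ` (\<lambda>w. (of_real r * ?e t) * w) ` ?D"
          by (simp add: image_comp)
        also have "(\<lambda>w. (of_real r * ?e t) * w) ` ?D = ball 0 r"
        proof (intro equalityI subsetI)
          fix v :: complex assume v: "v \<in> ball 0 r"
          show "v \<in> (\<lambda>w. (of_real r * ?e t) * w) ` ?D"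
            using v r by (intro image_eqI[of _ _ "v / (of_real r * ?e t)"]) (auto simp: norm_divide norm_mult)
        qed (use r in \<open>auto simp: norm_mult\<close>)
        also have "(\<lambda>w. a + w) ` ball 0 r = ball a r"
          using image_add_ball[of a 0 r] by simp
        finally show ?thesis .
      qed
      have "deriv \<phi> w = of_real r * ?e t" for w
        unfolding \<phi>_def by (rule DERIV_imp_deriv) (auto intro!: derivative_eq_intros)
      \<comment> \<open>The rotation factor has modulus 1, so only the scaling by r enters the
        Jacobian.\<close>
      then have d: "(norm (deriv \<phi> w))\<^sup>2 = r\<^sup>2" for w
        using r by (simp add: norm_mult)
      have hphi: "\<phi> holomorphic_on ?D"
        unfolding \<phi>_def by (intro holomorphic_intros)
      have cont: "continuous_on (cball a r) (\<lambda>w. norm (h w))"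
        by (intro continuous_on_norm continuous_on_subset[OF ch] sub)
      have cov: "set_integrable lborel ?D (\<lambda>z. r\<^sup>2 * norm (h (\<phi> z)))"
          "(LINT z:?D|lborel. r\<^sup>2 * norm (h (\<phi> z))) = I"
        using conformal_change_of_variables[OF open_ball hphi inj, of "\<lambda>w. norm (h w)"]
          continuous_on_subset[OF cont ball_subset_cball] set_integrable_ball_continuous[OF cont]
        unfolding img d I_def by auto
      have i: "set_integrable lborel ?D (\<lambda>z. norm (h (\<phi> z)))"
        using set_integrable_mult_right[of "1 / r\<^sup>2", OF cov(1)] r by simp
      have "(\<integral>\<^sup>+w. ennreal (H (w,t)) \<partial>lborel) = (\<integral>\<^sup>+w. ennreal (indicator ?D w *\<^sub>R norm (h (\<phi> w))) \<partial>lborel)"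
        using True by (auto simp: H_def \<phi>_def indicator_def intro!: nn_integral_cong)
      also have "\<dots> = ennreal (LINT z:?D|lborel. norm (h (\<phi> z)))"
        unfolding set_lebesgue_integral_def
        by (rule nn_integral_eq_integral) (use i in \<open>auto simp: set_integrable_def\<close>)
      also have "(LINT z:?D|lborel. norm (h (\<phi> z))) = I / r\<^sup>2"
        using cov(2) r by (simp add: field_simps)
      finally show ?thesis
        using True by simp
    qed (simp add: H_def)
  qed
  also have "\<dots> = ennreal (I / r\<^sup>2)"
    by (simp add: nn_integral_cmult_indicator)
  finally have "norm (h a) * pi \<le> I / r\<^sup>2"
    by (subst (asm) ennreal_le_iff)
      (auto simp: I_def set_lebesgue_integral_def intro!: divide_nonneg_nonneg Bochner_Integration.integral_nonneg)
  then show ?thesis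
    using r by (simp add: I_def field_simps)
qed

section \<open>From |h| to |h|^p: local estimates by area integrals\<close>

lemma set_integral_subset_mono:
  fixes f :: "'a \<Rightarrow> real"
  assumes int: "set_integrable M B f" and A: "A \<in> sets M" "A \<subseteq> B" and nn: "\<And>x. x \<in> B \<Longrightarrow> 0 \<le> f x"
  shows "(LINT x:A|M. f x) \<le> (LINT x:B|M. f x)"
proof -
  have "set_integrable M A f"
    using set_integrable_subset[OF int A] .
  then show ?thesis
    unfolding set_lebesgue_integral_def using int A(2) nn
    by (intro integral_mono) (auto simp: set_integrable_def indicator_def)
qed

lemma set_integral_nonneg:
  fixes f :: "'a \<Rightarrow> real"
  assumes "\<And>x. x \<in> A \<Longrightarrow> 0 \<le> f x"
  shows "0 \<le> (LINT x:A|M. f x)"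
  unfolding set_lebesgue_integral_def
  by (rule Bochner_Integration.integral_nonneg) (use assms in \<open>auto simp: indicator_def\<close>)

lemma set_integral_const_disc:
  "r \<ge> 0 \<Longrightarrow> (LINT w:ball (a::complex) r|lborel. c) = c * (pi * r\<^sup>2 :: real)"
  by (simp add: set_lebesgue_integral_def content_ball unit_ball_vol_2)

text \<open>For \<open>1 \<le> p\<close> this replaces Jensen's inequality: the integrand is at most
  \<open>t + t powr (1 - p) * norm (h w) powr p\<close> for every \<open>t > 0\<close>, and \<open>t = norm (h a) / 2\<close> suffices.\<close>

lemma norm_powr_le_disc_average_ge1:
  assumes S: "open S" and hol: "h holomorphic_on S" and r: "r > 0" and sub: "cball a r \<subseteq> S" and p: "1 \<le> p"
  shows "norm (h a) powr p * (pi * r\<^sup>2) \<le> 2 powr p * (LINT w:ball a r|lborel. norm (h w) powr p)"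
proof (cases "h a = 0")
  case True
  then show ?thesis
    by (simp add: set_integral_nonneg)
next
  case False
  define t where "t = norm (h a) / 2"
  define I where "I = (LINT w:ball a r|lborel. norm (h w) powr p)"
  have t: "t > 0"
    using False by (simp add: t_def)
  have cont: "continuous_on (cball a r) h"
    using holomorphic_on_imp_continuous_on[OF hol] sub continuous_on_subset by blast
  have i1: "set_integrable lborel (ball a r) (\<lambda>w. norm (h w))"
    by (intro set_integrable_ball_continuous continuous_on_norm cont)
  have i2: "set_integrable lborel (ball a r) (\<lambda>w. norm (h w) powr p)"
    by (intro set_integrable_ball_continuous continuous_on_powr' continuous_on_norm cont continuous_on_const)
      (use p in auto)
  have i3: "set_integrable lborel (ball a r) (\<lambda>w. t powr (1 - p) * norm (h w) powr p)"
    using i2 by simp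
  have i4: "set_integrable lborel (ball a r) (\<lambda>w. t)"
    by (intro set_integrable_ball_continuous continuous_on_const)
  have pw: "y \<le> t + t powr (1 - p) * y powr p" if "0 \<le> y" for y
  proof (cases "y \<le> t")
    case True
    then show ?thesis by (simp add: add_increasing2)
  next
    case False
    then have "y = y powr (1 - p) * y powr p"
      using t by (simp add: powr_add[symmetric])
    also have "\<dots> \<le> t powr (1 - p) * y powr p"
      using False t p by (intro mult_right_mono powr_mono2') auto
    finally show ?thesis
      using t by simp
  qed
  \<comment> \<open>Since 2 t = |h(a)|, one of the two copies of t absorbs the constant term of the
    pointwise bound and the other survives.\<close>
  have "2 * t * (pi * r\<^sup>2) \<le> (LINT w:ball a r|lborel. norm (h w))"
    using norm_le_disc_average[OF S hol r sub] by (simp add: t_def)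
  also have "\<dots> \<le> (LINT w:ball a r|lborel. t + t powr (1 - p) * norm (h w) powr p)"
    by (intro set_integral_mono i1 set_integral_add(1) i3 i4 pw) auto
  also have "\<dots> = t * (pi * r\<^sup>2) + t powr (1 - p) * I"
    using r by (simp add: set_integral_add(2)[OF i4 i3] set_integral_const_disc I_def)
  finally have "t * (pi * r\<^sup>2) \<le> t powr (1 - p) * I"
    by (simp add: mult_ac)
  then have "t powr (p - 1) * (t * (pi * r\<^sup>2)) \<le> t powr (p - 1) * (t powr (1 - p) * I)"
    by (rule mult_left_mono) simp
  also have "t powr (p - 1) * (t powr (1 - p) * I) = I"
    using t by (simp add: powr_add[symmetric] mult.assoc[symmetric])
  also have "t powr (p - 1) * (t * (pi * r\<^sup>2)) = t powr p * (pi * r\<^sup>2)"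
    using t by (simp add: powr_diff)
  finally have "t powr p * (pi * r\<^sup>2) \<le> I" .
  moreover have "norm (h a) powr p = 2 powr p * t powr p"
    by (simp add: t_def powr_divide)
  ultimately show ?thesis
    by (simp add: I_def mult.assoc mult_left_mono)
qed

text \<open>For \<open>p < 1\<close> compare \<open>h\<close> with its value at a point \<open>z\<close> maximising
  \<open>(r - dist a z) powr (2 / p) * norm (h z)\<close>: on the disc of radius \<open>(r - dist a z) / 2\<close> about \<open>z\<close>,
  \<open>norm h\<close> exceeds \<open>norm (h z)\<close> by at most a constant factor.\<close>

lemma norm_powr_le_disc_average_less1:
  assumes S: "open S" and hol: "h holomorphic_on S" and r: "r > 0" and sub: "cball a r \<subseteq> S"
    and p: "0 < p" "p < 1"
  shows "norm (h a) powr p * (pi * r\<^sup>2) \<le>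
           4 * (2 powr (2 / p)) powr (1 - p) * (LINT w:ball a r|lborel. norm (h w) powr p)"
proof -
  define I where "I = (LINT w:ball a r|lborel. norm (h w) powr p)"
  \<comment> \<open>The exponent 2 / p makes \<open>u z powr p\<close> equal to (r - dist a z)^2
    |h(z)|^p, which at z = a is the quantity to be bounded, up to the factor pi.\<close>
  define u where "u = (\<lambda>z. (r - dist a z) powr (2 / p) * norm (h z))"
  define K where "K = (2::real) powr (2 / p)"
  have cont: "continuous_on (cball a r) h"
    using holomorphic_on_imp_continuous_on[OF hol] sub continuous_on_subset by blast
  have i2: "set_integrable lborel (ball a r) (\<lambda>w. norm (h w) powr p)"
    by (intro set_integrable_ball_continuous continuous_on_powr' continuous_on_norm cont continuous_on_const)
      (use p in auto)
  have "continuous_on (cball a r) u"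
    unfolding u_def using p
    by (intro continuous_on_mult continuous_on_powr' continuous_on_norm cont continuous_on_const
        continuous_on_diff continuous_on_dist continuous_on_id) auto
  then obtain z where z: "z \<in> cball a r" and max: "\<And>w. w \<in> cball a r \<Longrightarrow> u w \<le> u z"
    using continuous_attains_sup[of "cball a r" u] r by auto
  have up: "u w powr p = (r - dist a w)\<^sup>2 * norm (h w) powr p" if "w \<in> cball a r" for w
    using that p by (simp add: u_def powr_mult powr_powr)
  have I0: "0 \<le> I"
    unfolding I_def by (rule set_integral_nonneg) simp
  have "u z powr p * pi \<le> 4 * K powr (1 - p) * I"
  \<comment> \<open>A maximiser on the boundary circle falls under this case; otherwise there is
    room for a disc about z.\<close>
  proof (cases "u z = 0")
    case True
    then show ?thesis using I0 by simp
  next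
    case False
    define \<rho> where "\<rho> = (r - dist a z) / 2"
    define x where "x = norm (h z)"
    from False z have \<rho>: "\<rho> > 0" and x: "x > 0"
      by (auto simp: u_def \<rho>_def x_def)
    have sub\<rho>: "cball z \<rho> \<subseteq> cball a r"
      using \<rho> by (auto simp: \<rho>_def cball_subset_cball_iff dist_commute field_simps)
    have sub\<rho>': "ball z \<rho> \<subseteq> ball a r"
      using \<rho> by (auto simp: \<rho>_def ball_subset_ball_iff dist_commute field_simps)
    \<comment> \<open>Within distance \<rho> of z, the distance to the boundary circle at most
      halves, so maximality of \<open>u z\<close> bounds |h(w)| at the price of the factor
      \<open>K\<close> = 2^(2/p).\<close>
    have bound: "norm (h w) \<le> K * x" if "w \<in> ball z \<rho>" for w
    proof -
      have w: "w \<in> cball a r"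
        using that sub\<rho> ball_subset_cball by blast
      have "\<rho> \<le> r - dist a w"
        using that dist_triangle[of a w z] by (simp add: \<rho>_def dist_commute)
      then have "\<rho> powr (2 / p) * norm (h w) \<le> u w"
        unfolding u_def using \<rho> p by (intro mult_right_mono powr_mono2) auto
      also have "\<dots> \<le> u z"
        using max[OF w] .
      also have "\<dots> = (2 * \<rho>) powr (2 / p) * x"
        unfolding u_def \<rho>_def x_def by (simp only: mult_2 field_sum_of_halves)
      also have "\<dots> = \<rho> powr (2 / p) * (K * x)"
        using \<rho> by (simp add: powr_mult K_def)
      finally show ?thesis
        using \<rho> by simp
    qed
    \<comment> \<open>Only |h|^(1 - p) is estimated by the maximum; the remaining |h|^p is the
      integrand of the claim.\<close>
    have pw: "norm (h w) \<le> (K * x) powr (1 - p) * norm (h w) powr p" if "w \<in> ball z \<rho>" for w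
    proof -
      have "norm (h w) = norm (h w) powr (1 - p) * norm (h w) powr p"
        by (cases "h w = 0") (simp_all add: powr_add[symmetric])
      also have "\<dots> \<le> (K * x) powr (1 - p) * norm (h w) powr p"
        using bound[OF that] p by (intro mult_right_mono powr_mono2) auto
      finally show ?thesis .
    qed
    have i3: "set_integrable lborel (ball z \<rho>) (\<lambda>w. norm (h w) powr p)"
      by (rule set_integrable_subset[OF i2]) (use sub\<rho>' in auto)
    have "x * (pi * \<rho>\<^sup>2) \<le> (LINT w:ball z \<rho>|lborel. norm (h w))"
      using norm_le_disc_average[OF S hol \<rho>] sub\<rho> sub by (auto simp: x_def)
    also have "\<dots> \<le> (LINT w:ball z \<rho>|lborel. (K * x) powr (1 - p) * norm (h w) powr p)"
    proof (rule set_integral_mono)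
      show "set_integrable lborel (ball z \<rho>) (\<lambda>w. norm (h w))"
        by (intro set_integrable_ball_continuous continuous_on_norm continuous_on_subset[OF cont] sub\<rho>)
    qed (use i3 pw in auto)
    also have "\<dots> \<le> (K * x) powr (1 - p) * I"
      unfolding I_def using i2 sub\<rho>'
      by (auto intro!: mult_left_mono set_integral_subset_mono)
    also have "\<dots> = x powr (1 - p) * (K powr (1 - p) * I)"
      using x by (simp add: powr_mult K_def)
    finally have "x powr (p - 1) * (x * (pi * \<rho>\<^sup>2)) \<le> x powr (p - 1) * (x powr (1 - p) * (K powr (1 - p) * I))"
      by (rule mult_left_mono) simp
    also have "\<dots> = K powr (1 - p) * I"
      using x by (simp add: powr_add[symmetric] mult.assoc[symmetric])
    also have "x powr (p - 1) * (x * (pi * \<rho>\<^sup>2)) = x powr p * (pi * \<rho>\<^sup>2)"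
      using x by (simp add: powr_diff)
    \<comment> \<open>The factor 4 converts \<rho>^2 into (r - dist a z)^2 = (2 \<rho>)^2.\<close>
    finally have "4 * (x powr p * (pi * \<rho>\<^sup>2)) \<le> 4 * (K powr (1 - p) * I)"
      by simp
    then show ?thesis
      using up[OF z] by (simp add: \<rho>_def x_def power_divide mult_ac)
  qed
  moreover have "u a powr p \<le> u z powr p"
    using max[of a] r p by (intro powr_mono2) (auto simp: u_def)
  moreover have "u a powr p = r\<^sup>2 * norm (h a) powr p"
    using up[of a] r by simp
  ultimately have "r\<^sup>2 * norm (h a) powr p * pi \<le> 4 * K powr (1 - p) * I"
    by (metis (no_types) mult_right_mono order_trans pi_ge_zero)
  then show ?thesis
    by (simp add: I_def K_def mult_ac)
qed

text \<open>The point is uniformity: the constant depends on p alone, so the disc may shrink as its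
  centre approaches the unit circle.\<close>

lemma norm_powr_le_disc_average:
  assumes p: "0 < (p::real)"
  obtains C where "C > 0"
    "\<And>S h a r. \<lbrakk>open S; h holomorphic_on S; r > 0; cball a r \<subseteq> S\<rbrakk> \<Longrightarrow>
       norm (h a) powr p * r\<^sup>2 \<le> C * (LINT w:ball a r|lborel. norm (h w) powr p)"
proof
  define B where "B = (if p < 1 then 4 * (2 powr (2 / p)) powr (1 - p) else 2 powr p)"
  show "B / pi > 0"
    by (simp add: B_def)
  show "norm (h a) powr p * r\<^sup>2 \<le> B / pi * (LINT w:ball a r|lborel. norm (h w) powr p)"
    if "open S" "h holomorphic_on S" "r > 0" "cball a r \<subseteq> S" for S h a r
    using norm_powr_le_disc_average_less1[OF that p] norm_powr_le_disc_average_ge1[OF that, of p]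
    by (auto simp: B_def field_simps split: if_splits)
qed

text \<open>On the disc of radius r = (1 - |z|) / 2 about z, the quantities 1 - |w|^2 and 1 - |z|^2
  differ by a factor of at most 4 either way. The weight therefore passes under the integral at the
  cost of 4^|\<gamma>|, and the area r^2 contributes the 2 in the exponent 2 + \<gamma>.\<close>

lemma weighted_point_estimate:
  fixes p \<gamma> :: real
  assumes p: "0 < p"
  obtains C where "C > 0"
    "\<And>h z. \<lbrakk>h holomorphic_on ball 0 1;
        set_integrable lborel (ball 0 1) (\<lambda>w. norm (h w) powr p * (1 - (norm w)\<^sup>2) powr \<gamma>);
        z \<in> ball 0 1\<rbrakk> \<Longrightarrow>
      norm (h z) powr p * (1 - (norm z)\<^sup>2) powr (2 + \<gamma>) \<le>
        C * (LINT w:ball 0 1|lborel. norm (h w) powr p * (1 - (norm w)\<^sup>2) powr \<gamma>)"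
proof -
  obtain C where C: "C > 0" and disc: "\<And>S h a r. \<lbrakk>open S; h holomorphic_on S; r > 0; cball a r \<subseteq> S\<rbrakk> \<Longrightarrow>
       norm (h a) powr p * r\<^sup>2 \<le> C * (LINT w:ball a r|lborel. norm (h w) powr p)"
    using norm_powr_le_disc_average[OF p] by blast
  define B where "B = (4::real) powr \<bar>\<gamma>\<bar>"
  have "norm (h z) powr p * (1 - (norm z)\<^sup>2) powr (2 + \<gamma>) \<le>
        16 * C * B * (LINT w:ball 0 1|lborel. norm (h w) powr p * (1 - (norm w)\<^sup>2) powr \<gamma>)"
    if hol: "h holomorphic_on ball 0 1"
      and int: "set_integrable lborel (ball 0 1) (\<lambda>w. norm (h w) powr p * (1 - (norm w)\<^sup>2) powr \<gamma>)"
      and z: "z \<in> ball 0 1" for h and z :: complex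
  proof -
    define r where "r = (1 - norm z) / 2"
    define d where "d = 1 - (norm z)\<^sup>2"
    have d: "d = (1 - norm z) * (1 + norm z)"
      by (simp add: d_def power2_eq_square algebra_simps)
    have r: "r > 0"
      using z by (simp add: r_def)
    have d0: "d > 0"
      using z unfolding d by (intro mult_pos_pos add_pos_nonneg) auto
    have rd: "d \<le> 4 * r"
      using z mult_left_mono[of "1 + norm z" 2 "1 - norm z"] by (simp add: d r_def)
    have sub: "cball z r \<subseteq> ball 0 1"
      using r by (auto simp: r_def cball_subset_ball_iff field_simps)
    \<comment> \<open>The sign of \<gamma> decides which side of the comparison is used: d \<le> 4 e
      when \<gamma> \<ge> 0, and e \<le> 4 d when \<gamma> < 0.\<close>
    have wt: "d powr \<gamma> \<le> B * (1 - (norm w)\<^sup>2) powr \<gamma>" if w: "w \<in> ball z r" for w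
    proof -
      define e where "e = 1 - (norm w)\<^sup>2"
      have e: "e = (1 - norm w) * (1 + norm w)"
        by (simp add: e_def power2_eq_square algebra_simps)
      have "norm w < norm z + r" "norm z < norm w + r"
        using w norm_triangle_sub[of w z] norm_triangle_sub[of z w]
        by (auto simp: dist_norm norm_minus_commute)
      then have w1: "r < 1 - norm w" "1 - norm w < 3 * r"
        by (auto simp: r_def field_simps)
      have "(1 - norm w) * 1 \<le> e"
        unfolding e using w1 r by (intro mult_left_mono) auto
      with w1 have "r \<le> e"
        by simp
      then have de: "d \<le> 4 * e"
        using rd by simp
      have "e \<le> (1 - norm w) * 2"
        unfolding e using w1 r by (intro mult_left_mono) auto
      also have "\<dots> \<le> 3 * (2 * r)"
        using w1 by simp
      also have "2 * r = (1 - norm z) * 1"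
        by (simp add: r_def)
      also have "\<dots> \<le> d"
        unfolding d using z by (intro mult_left_mono) auto
      finally have ed: "e \<le> 4 * d"
        using d0 by simp
      have e0: "e > 0"
        using \<open>r \<le> e\<close> r by simp
      show ?thesis
      proof (cases "\<gamma> \<ge> 0")
        case True
        then have "d powr \<gamma> \<le> (4 * e) powr \<gamma>"
          using de d0 by (intro powr_mono2) auto
        then show ?thesis
          using True e0 by (simp add: B_def powr_mult e_def[symmetric])
      next
        case False
        then have "d powr \<gamma> \<le> (e / 4) powr \<gamma>"
          using ed e0 by (intro powr_mono2') auto
        also have "\<dots> = 4 powr (- \<gamma>) * e powr \<gamma>"
          using e0 by (simp add: powr_divide powr_minus field_simps)
        finally show ?thesis
          using False by (simp add: B_def e_def[symmetric])
      qed
    qed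
    let ?f = "\<lambda>w. norm (h w) powr p * (1 - (norm w)\<^sup>2) powr \<gamma>"
    have sub': "ball z r \<subseteq> ball 0 1"
      using sub ball_subset_cball by blast
    have i: "set_integrable lborel (ball z r) ?f"
      by (rule set_integrable_subset[OF int]) (use sub' in auto)
    have cont: "continuous_on (cball z r) h"
      using holomorphic_on_imp_continuous_on[OF hol] sub continuous_on_subset by blast
    have ip: "set_integrable lborel (ball z r) (\<lambda>w. norm (h w) powr p)"
      by (intro set_integrable_ball_continuous continuous_on_powr' continuous_on_norm cont continuous_on_const)
        (use p in auto)
    have "d powr \<gamma> * (LINT w:ball z r|lborel. norm (h w) powr p) =
        (LINT w:ball z r|lborel. d powr \<gamma> * norm (h w) powr p)"
      by simp
    also have "\<dots> \<le> (LINT w:ball z r|lborel. B * ?f w)"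
    proof (rule set_integral_mono)
      show "d powr \<gamma> * norm (h w) powr p \<le> B * ?f w" if "w \<in> ball z r" for w
        using mult_right_mono[OF wt[OF that], of "norm (h w) powr p"] by (simp add: mult_ac)
    qed (use i ip in auto)
    also have "\<dots> = B * (LINT w:ball z r|lborel. ?f w)"
      by simp
    also have "\<dots> \<le> B * (LINT w:ball 0 1|lborel. ?f w)"
      using int sub' by (intro mult_left_mono set_integral_subset_mono) (auto simp: B_def)
    finally have *: "d powr \<gamma> * (LINT w:ball z r|lborel. norm (h w) powr p) \<le> B * (LINT w:ball 0 1|lborel. ?f w)" .
    \<comment> \<open>This is the source of the constant 16: 1 - |z|^2 is at most 2 (1 - |z|) = 4
      r.\<close>
    have "d\<^sup>2 \<le> 16 * r\<^sup>2"
      using power_mono[OF rd, of 2] d0 by (simp add: power_mult_distrib)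
    then have "norm (h z) powr p * d\<^sup>2 \<le> 16 * (norm (h z) powr p * r\<^sup>2)"
      using mult_left_mono[of "d\<^sup>2" "16 * r\<^sup>2" "norm (h z) powr p"] by simp
    also have "\<dots> \<le> 16 * (C * (LINT w:ball z r|lborel. norm (h w) powr p))"
      using disc[OF open_ball hol r sub] by simp
    finally have "d powr \<gamma> * (norm (h z) powr p * d\<^sup>2) \<le>
        d powr \<gamma> * (16 * (C * (LINT w:ball z r|lborel. norm (h w) powr p)))"
      by (rule mult_left_mono) simp
    also have "\<dots> = 16 * C * (d powr \<gamma> * (LINT w:ball z r|lborel. norm (h w) powr p))"
      by simp
    also have "\<dots> \<le> 16 * C * (B * (LINT w:ball 0 1|lborel. ?f w))"
      using * C by (intro mult_left_mono) auto
    finally show ?thesis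
      using d0 by (simp add: powr_add d_def[symmetric] mult_ac)
  qed
  moreover have "16 * C * B > 0"
    using C by (simp add: B_def)
  ultimately show ?thesis
    using that by blast
qed

section \<open>Test functions\<close>

lemma exists_dyadic_scale:
  fixes x :: real
  assumes "0 < x" "x \<le> 1"
  obtains n :: nat where "(1/2) ^ Suc n < x" "x \<le> (1/2) ^ n"
proof -
  have "\<exists>m. (1/2) ^ m < x"
    using real_arch_pow_inv[of x "1/2"] assms by auto
  then obtain m where m: "(1/2) ^ m < x" and least: "\<And>k. k < m \<Longrightarrow> \<not> (1/2) ^ k < x"
    using exists_least_iff[of "\<lambda>m. (1/2) ^ m < x"] by blast
  with assms obtain n where "m = Suc n"
    by (cases m) auto
  then show ?thesis
    using that[of n] m least[of n] by auto
qed

text \<open>A dyadic decomposition: the region where 1 - |z|^2 \<le> 2^(-n) has area exactly pi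
  2^(-n), and where 1 - |z|^2 is of size 2^(-n) the weight is at most a constant times 2^(-n
  \<alpha>). The resulting series is geometric.\<close>

lemma set_integrable_disc_weight:
  assumes \<alpha>: "\<alpha> > -1"
  shows "set_integrable lborel (ball 0 1) (\<lambda>z::complex. (1 - (norm z)\<^sup>2) powr \<alpha>)"
proof -
  \<comment> \<open>The factor 2^|\<alpha>| covers both signs of \<alpha>: for \<alpha> < 0 the
    weight is largest at the outer end of the shell, where 1 - |z|^2 is near 2^(-n-1).\<close>
  define c where "c = (\<lambda>n::nat. 2 powr \<bar>\<alpha>\<bar> * ((1/2) ^ n) powr \<alpha>)"
  \<comment> \<open>These sets are nested rather than disjoint; the overlap is harmless for an upper
    bound.\<close>
  define A where "A = (\<lambda>n::nat. ball (0::complex) 1 - ball 0 (sqrt (1 - (1/2) ^ n)))"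
  let ?f = "\<lambda>z::complex. indicator (ball 0 1) z *\<^sub>R (1 - (norm z)\<^sup>2) powr \<alpha>"
  have c0: "c n \<ge> 0" for n
    by (simp add: c_def)
  have A: "A n \<in> sets lborel" for n
    by (simp add: A_def)
  have half: "0 \<le> 1 - (1/2 :: real) ^ n" for n
    by (simp add: power_le_one)
  have eA: "emeasure lborel (A n) = ennreal (pi * (1/2) ^ n)" for n
  proof -
    have sub: "ball 0 (sqrt (1 - (1/2) ^ n)) \<subseteq> ball (0::complex) 1"
      by (auto simp: ball_subset_ball_iff)
    have "emeasure lborel (A n) = emeasure lborel (ball (0::complex) 1) - emeasure lborel (ball (0::complex) (sqrt (1 - (1/2) ^ n)))"
      unfolding A_def using half[of n] sub
      by (intro emeasure_Diff) (auto simp: emeasure_ball unit_ball_vol_2)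
    also have "\<dots> = ennreal pi - ennreal (pi * (1 - (1/2) ^ n))"
      using half[of n] by (simp add: emeasure_ball unit_ball_vol_2)
    also have "\<dots> = ennreal (pi - pi * (1 - (1/2) ^ n))"
      by (rule ennreal_minus) (use half[of n] in simp)
    also have "pi - pi * (1 - (1/2) ^ n) = pi * (1/2) ^ n"
      by (simp add: algebra_simps)
    finally show ?thesis .
  qed
  have bound: "ennreal (?f z) \<le> (\<Sum>n. ennreal (c n) * indicator (A n) z)" for z
  proof (cases "z \<in> ball 0 1")
    case True
    define x where "x = 1 - (norm z)\<^sup>2"
    have "0 < x" "x \<le> 1"
      using True by (auto simp: x_def abs_square_less_1)
    then obtain n where n: "(1/2) ^ Suc n < x" "x \<le> (1/2) ^ n"
      by (rule exists_dyadic_scale)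
    have "x powr \<alpha> \<le> c n"
    proof (cases "\<alpha> \<ge> 0")
      case True
      then have "x powr \<alpha> \<le> 1 * ((1/2) ^ n) powr \<alpha>"
        using \<open>0 < x\<close> n by (simp add: powr_mono2)
      also have "\<dots> \<le> c n"
        unfolding c_def by (intro mult_right_mono) (auto simp: ge_one_powr_ge_zero)
      finally show ?thesis .
    next
      case False
      then have "x powr \<alpha> \<le> ((1/2) ^ n / 2) powr \<alpha>"
        using n by (intro powr_mono2') auto
      also have "\<dots> = c n"
        using False by (simp add: c_def powr_divide powr_mult powr_minus field_simps)
      finally show ?thesis .
    qed
    moreover have "z \<in> A n"
    proof -
      have "1 - (1/2) ^ n \<le> (norm z)\<^sup>2"
        using n by (simp add: x_def)
      then have "sqrt (1 - (1/2) ^ n) \<le> norm z"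
        by (rule real_le_lsqrt[rotated -1]) (auto)
      then show ?thesis
        using True by (simp add: A_def)
    qed
    ultimately have "ennreal (?f z) \<le> ennreal (c n) * indicator (A n) z"
      using True by (simp add: x_def ennreal_leI)
    also have "\<dots> \<le> (\<Sum>n. ennreal (c n) * indicator (A n) z)"
    proof -
      define e where "e = (\<lambda>n. ennreal (c n) * indicator (A n) z)"
      have "e n \<le> suminf e"
        using sum_le_suminf[of e "{n}"] by simp
      then show ?thesis
        unfolding e_def .
    qed
    finally show ?thesis .
  qed simp
  \<comment> \<open>Convergence of the series is exactly the condition \<alpha> > -1.\<close>
  have ratio: "(1/2::real) powr (\<alpha> + 1) < 1"
    using \<alpha> powr_less_mono2[of "\<alpha> + 1" "1/2" 1] by simp
  have geom: "c n * (pi * (1/2) ^ n) = 2 powr \<bar>\<alpha>\<bar> * pi * ((1/2) powr (\<alpha> + 1)) ^ n" for n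
  proof -
    have "((1/2::real) ^ n) powr \<alpha> = ((1/2) powr \<alpha>) ^ n"
      by (simp add: powr_realpow[symmetric] powr_powr mult.commute)
    then show ?thesis
      by (simp add: c_def powr_add flip: power_mult_distrib)
  qed
  have "summable (\<lambda>n. c n * (pi * (1/2) ^ n))"
    unfolding geom by (intro summable_mult summable_geometric) (use ratio in auto)
  have "(\<integral>\<^sup>+z. ennreal (?f z) \<partial>lborel) \<le> (\<integral>\<^sup>+z. (\<Sum>n. ennreal (c n) * indicator (A n) z) \<partial>lborel)"
    by (intro nn_integral_mono bound)
  also have "\<dots> = (\<Sum>n. \<integral>\<^sup>+z. ennreal (c n) * indicator (A n) z \<partial>lborel)"
    using A by (intro nn_integral_suminf) auto
  also have "\<dots> = (\<Sum>n. ennreal (c n * (pi * (1/2) ^ n)))"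
    using A eA c0 by (simp add: nn_integral_cmult_indicator ennreal_mult)
  also have "\<dots> < \<infinity>"
    using \<open>summable _\<close> c0 by (simp add: suminf_ennreal2 less_top[symmetric] ennreal_suminf_neq_top)
  finally have fin: "(\<integral>\<^sup>+z. ennreal (?f z) \<partial>lborel) < \<infinity>" .
  have "?f \<in> borel_measurable borel"
    by (intro borel_measurable_continuous_on_indicator continuous_intros) (auto simp: abs_square_eq_1)
  then show ?thesis
    unfolding set_integrable_def using fin by (intro integrableI_nonneg) auto
qed

section \<open>Disc automorphisms and the functions built from them\<close>

lemma one_minus_cnj_mult_in_right_half_plane:
  assumes "a \<in> ball 0 1" "z \<in> ball (0::complex) 1"
  shows "0 < Re (1 - cnj a * z)" "1 - cnj a * z \<noteq> 0"
proof -
  have "norm (cnj a * z) < 1"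
    using assms norm_mult_less[of "cnj a" 1 z 1] by simp
  then show "0 < Re (1 - cnj a * z)"
    using complex_Re_le_cmod[of "cnj a * z"] by simp
  then show "1 - cnj a * z \<noteq> 0"
    by (metis less_irrefl zero_complex.simps(1))
qed

text \<open>Together with \<open>deriv_Moebius\<close> this is the equality case of the Schwarz-Pick
  lemma: 1 - |phi(z)|^2 = |phi'(z)| (1 - |z|^2).\<close>

lemma one_minus_norm_Moebius:
  assumes "a \<in> ball 0 1" "z \<in> ball 0 1"
  shows "1 - (norm (Moebius_function 0 a z))\<^sup>2 =
           (1 - (norm a)\<^sup>2) * (1 - (norm z)\<^sup>2) / (norm (1 - cnj a * z))\<^sup>2"
proof -
  have "(norm (1 - cnj a * z))\<^sup>2 - (norm (z - a))\<^sup>2 = (1 - (norm a)\<^sup>2) * (1 - (norm z)\<^sup>2)"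
    unfolding cmod_power2 by (simp add: power2_eq_square algebra_simps)
  moreover have "(norm (1 - cnj a * z))\<^sup>2 \<noteq> 0"
    using one_minus_cnj_mult_in_right_half_plane[OF assms] by simp
  ultimately show ?thesis
    by (simp add: Moebius_function_simple norm_divide power_divide field_simps)
qed

lemma of_real_one_minus_norm_square: "of_real (1 - (norm a)\<^sup>2) = 1 - cnj a * a"
  using complex_norm_square[of a] by (simp add: mult.commute)

lemma deriv_Moebius:
  assumes "a \<in> ball 0 1" "z \<in> ball 0 1"
  shows "deriv (Moebius_function 0 a) z = of_real (1 - (norm a)\<^sup>2) / (1 - cnj a * z)\<^sup>2"
proof (rule DERIV_imp_deriv)
  have nz: "1 - cnj a * z \<noteq> 0"
    using one_minus_cnj_mult_in_right_half_plane[OF assms] by simp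
  have "((\<lambda>z. (z - a) / (1 - cnj a * z)) has_field_derivative
          (1 * (1 - cnj a * z) - (z - a) * (- cnj a)) / ((1 - cnj a * z) * (1 - cnj a * z))) (at z)"
    using nz by (auto intro!: derivative_eq_intros)
  moreover have "1 * (1 - cnj a * z) - (z - a) * (- cnj a) = of_real (1 - (norm a)\<^sup>2)"
    unfolding of_real_one_minus_norm_square by (simp add: algebra_simps)
  ultimately show "(Moebius_function 0 a has_field_derivative of_real (1 - (norm a)\<^sup>2) / (1 - cnj a * z)\<^sup>2) (at z)"
    by (simp only: Moebius_function_simple[abs_def] power2_eq_square[of "1 - cnj a * z"])
qed

text \<open>\<open>f\<close> is the pullback of the weight under the automorphism phi of the disc.
  In the exponent 2 + \<alpha> of |phi'|, the 2 is the Jacobian and \<alpha> comes from 1 - |phi|^2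
  = |phi'| (1 - |z|^2).\<close>

lemma Moebius_weight_integral:
  fixes \<alpha> :: real
  assumes \<alpha>: "\<alpha> > -1" and a: "a \<in> ball 0 1"
  defines "f \<equiv> \<lambda>z. ((1 - (norm a)\<^sup>2) / (norm (1 - cnj a * z))\<^sup>2) powr (2 + \<alpha>) * (1 - (norm z)\<^sup>2) powr \<alpha>"
  shows "set_integrable lborel (ball 0 1) f"
    and "(LINT z:ball 0 1|lborel. f z) = (LINT w:ball (0::complex) 1|lborel. (1 - (norm w)\<^sup>2) powr \<alpha>)"
proof -
  let ?\<phi> = "Moebius_function 0 a" and ?D = "ball (0::complex) 1"
  let ?W = "\<lambda>w::complex. (1 - (norm w)\<^sup>2) powr \<alpha>"
  have na: "norm a < 1" "norm (- a) < 1"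
    using a by auto
  have inv: "Moebius_function 0 (- a) (?\<phi> z) = z" "?\<phi> (Moebius_function 0 (- a) z) = z" if "z \<in> ?D" for z
    using that na by (auto intro!: Moebius_function_compose)
  have inj: "inj_on ?\<phi> ?D"
    using inv(1) by (metis inj_on_inverseI)
  have img: "?\<phi> ` ?D = ?D"
  proof
    show "?\<phi> ` ?D \<subseteq> ?D"
      using Moebius_function_norm_lt_1[OF na(1)] by auto
    show "?D \<subseteq> ?\<phi> ` ?D"
    proof
      fix w assume "w \<in> ?D"
      then show "w \<in> ?\<phi> ` ?D"
        using inv(2)[of w] Moebius_function_norm_lt_1[OF na(2), of w 0]
        by (intro image_eqI[of _ _ "Moebius_function 0 (- a) w"]) auto
    qed
  qed
  have hol: "?\<phi> holomorphic_on ?D"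
    by (rule Moebius_function_holomorphic[OF na(1)])
  have cont: "continuous_on ?D ?W"
    by (intro continuous_intros) (auto simp: abs_square_eq_1)
  have eq: "(norm (deriv ?\<phi> z))\<^sup>2 * ?W (?\<phi> z) = f z" if z: "z \<in> ?D" for z
  proof -
    define x where "x = (1 - (norm a)\<^sup>2) / (norm (1 - cnj a * z))\<^sup>2"
    have "1 - (norm a)\<^sup>2 > 0"
      using na by (simp add: abs_square_less_1)
    then have x: "x > 0"
      using one_minus_cnj_mult_in_right_half_plane[OF a z] by (simp add: x_def)
    have "norm (deriv ?\<phi> z) = x"
      using \<open>1 - (norm a)\<^sup>2 > 0\<close>
      by (simp only: deriv_Moebius[OF a z] norm_divide norm_power norm_of_real x_def)
    moreover have "1 - (norm (?\<phi> z))\<^sup>2 = x * (1 - (norm z)\<^sup>2)"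
      by (simp add: one_minus_norm_Moebius[OF a z] x_def)
    moreover have "1 - (norm z)\<^sup>2 \<ge> 0"
      using z by (simp add: abs_square_le_1)
    ultimately have "(norm (deriv ?\<phi> z))\<^sup>2 * ?W (?\<phi> z) = x powr (2 + \<alpha>) * (1 - (norm z)\<^sup>2) powr \<alpha>"
      using x by (simp add: powr_mult powr_add)
    then show ?thesis
      by (simp add: f_def x_def)
  qed
  have cov: "set_integrable lborel ?D (\<lambda>z. (norm (deriv ?\<phi> z))\<^sup>2 * ?W (?\<phi> z))"
      "(LINT z:?D|lborel. (norm (deriv ?\<phi> z))\<^sup>2 * ?W (?\<phi> z)) = (LINT w:?D|lborel. ?W w)"
    using conformal_change_of_variables[OF open_ball hol inj, of ?W] cont set_integrable_disc_weight[OF \<alpha>]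
    unfolding img by blast+
  show "set_integrable lborel ?D f"
    using cov(1) by (subst (asm) set_integrable_cong[OF refl refl eq])
  show "(LINT z:?D|lborel. f z) = (LINT w:?D|lborel. ?W w)"
    using cov(2) by (subst (asm) set_lebesgue_integral_cong[OF _ allI[OF impI[OF eq]]]) auto
qed

lemma exists_test_function:
  fixes \<alpha> p :: real
  assumes \<alpha>: "\<alpha> > -1" and p: "p > 0" and a: "a \<in> ball 0 1"
  obtains h where "h holomorphic_on ball 0 1"
    "set_integrable lborel (ball 0 1) (\<lambda>z. norm (h z) powr p * (1 - (norm z)\<^sup>2) powr \<alpha>)"
    "(LINT z:ball 0 1|lborel. norm (h z) powr p * (1 - (norm z)\<^sup>2) powr \<alpha>) =
       (LINT z:ball (0::complex) 1|lborel. (1 - (norm z)\<^sup>2) powr \<alpha>)"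
    "norm (h a) = (1 - (norm a)\<^sup>2) powr (- ((2 + \<alpha>) / p))"
proof -
  define s where "s = (2 + \<alpha>) / p"
  define d where "d = 1 - (norm a)\<^sup>2"
  \<comment> \<open>A holomorphic branch of phi'^s for phi = \<open>Moebius_function 0 a\<close>. It
    exists because 1 - cnj a z stays in the right half-plane, away from the cut of
    \<open>Ln\<close>.\<close>
  define h where "h = (\<lambda>z. exp (of_real s * (of_real (ln d) - 2 * Ln (1 - cnj a * z))))"
  have d: "d > 0"
    using a by (simp add: d_def abs_square_less_1)
  have hol: "h holomorphic_on ball 0 1"
    unfolding h_def
    by (intro holomorphic_intros) (use one_minus_cnj_mult_in_right_half_plane[OF a] complex_nonpos_Reals_iff in \<open>force\<close>)
  have nh: "norm (h z) = (d / (norm (1 - cnj a * z))\<^sup>2) powr s" if "z \<in> ball 0 1" for z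
    using one_minus_cnj_mult_in_right_half_plane(2)[OF a that] d
    by (simp add: h_def norm_exp_eq_Re Re_Ln powr_def ln_div ln_realpow)
  have eq: "norm (h z) powr p * (1 - (norm z)\<^sup>2) powr \<alpha> =
      ((1 - (norm a)\<^sup>2) / (norm (1 - cnj a * z))\<^sup>2) powr (2 + \<alpha>) * (1 - (norm z)\<^sup>2) powr \<alpha>"
    if "z \<in> ball 0 1" for z
    using p by (simp add: nh[OF that] powr_powr s_def d_def)
  show ?thesis
  proof (rule that[OF hol])
    show "set_integrable lborel (ball 0 1) (\<lambda>z. norm (h z) powr p * (1 - (norm z)\<^sup>2) powr \<alpha>)"
      using Moebius_weight_integral(1)[OF \<alpha> a] by (subst set_integrable_cong[OF refl refl eq])
    show "(LINT z:ball 0 1|lborel. norm (h z) powr p * (1 - (norm z)\<^sup>2) powr \<alpha>) =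
       (LINT z:ball (0::complex) 1|lborel. (1 - (norm z)\<^sup>2) powr \<alpha>)"
      using Moebius_weight_integral(2)[OF \<alpha> a]
      by (subst set_lebesgue_integral_cong[OF _ allI[OF impI[OF eq]]]) auto
    have "1 - cnj a * a = of_real d"
      by (simp only: d_def of_real_one_minus_norm_square)
    then have "norm (1 - cnj a * a) = d"
      using d by simp
    then have "norm (h a) = (1 / d) powr s"
      using nh[OF a] d by (simp add: power2_eq_square)
    then show "norm (h a) = (1 - (norm a)\<^sup>2) powr (- ((2 + \<alpha>) / p))"
      using d by (simp add: powr_divide powr_minus s_def d_def inverse_eq_divide)
  qed
qed

section \<open>Multipliers and the operator\<close>

abbreviation weighted_integrand :: "real \<Rightarrow> real \<Rightarrow> (complex \<Rightarrow> complex) \<Rightarrow> complex \<Rightarrow> real" where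
  "weighted_integrand p \<alpha> h z \<equiv> norm (h z) powr p * (1 - (norm z)\<^sup>2) powr \<alpha>"

abbreviation weighted_integral :: "real \<Rightarrow> real \<Rightarrow> (complex \<Rightarrow> complex) \<Rightarrow> real" where
  "weighted_integral p \<alpha> h \<equiv> (LINT z:ball 0 1|lborel. weighted_integrand p \<alpha> h z)"

text \<open>The operator inequality raised to the power q, which explains the exponent q / p. The
  normalisation of area is absorbed into \<open>K\<close>.\<close>

definition weighted_multiplier_bound where
  "weighted_multiplier_bound p \<alpha> q \<beta> g K \<longleftrightarrow> K \<ge> 0 \<and>
     (\<forall>h. h holomorphic_on ball 0 1 \<longrightarrow> set_integrable lborel (ball 0 1) (weighted_integrand p \<alpha> h) \<longrightarrow>
        set_integrable lborel (ball 0 1) (weighted_integrand q \<beta> (\<lambda>z. h z * g z)) \<and>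
        weighted_integral q \<beta> (\<lambda>z. h z * g z) \<le> K * weighted_integral p \<alpha> h powr (q / p))"

lemma set_integrable_area_measure:
  fixes f :: "complex \<Rightarrow> real"
  shows "set_integrable area_measure A f \<longleftrightarrow> set_integrable lborel A f"
proof -
  let ?f = "\<lambda>x. indicator A x *\<^sub>R f x"
  have "integrable area_measure ?f \<longleftrightarrow> integrable lborel ?f" if "?f \<in> borel_measurable lborel"
    unfolding area_measure_def using that integrable_mult_left_iff[of lborel "1 / pi" ?f]
    by (subst integrable_density) auto
  moreover have "?f \<in> borel_measurable lborel" if "integrable area_measure ?f"
    using borel_measurable_integrable[OF that] by (simp add: area_measure_def)
  moreover have "?f \<in> borel_measurable lborel" if "integrable lborel ?f"
    using borel_measurable_integrable[OF that] .
  ultimately show ?thesis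
    unfolding set_integrable_def by blast
qed

lemma set_integral_area_measure:
  fixes f :: "complex \<Rightarrow> real"
  assumes "set_integrable lborel A f"
  shows "(LINT z:A|area_measure. f z) = (LINT z:A|lborel. f z) / pi"
  using borel_measurable_integrable[OF assms[unfolded set_integrable_def]]
  unfolding set_lebesgue_integral_def area_measure_def
  by (subst integral_density) auto

lemma dirichlet_space_iff:
  "f \<in> dirichlet_space p \<alpha> \<longleftrightarrow> f holomorphic_on ball 0 1 \<and>
     set_integrable lborel (ball 0 1) (weighted_integrand p \<alpha> (deriv f))"
  by (simp add: dirichlet_space_def set_integrable_area_measure dirichlet_integrand_def[abs_def])

lemma dirichlet_norm_eq:
  assumes "f \<in> dirichlet_space p \<alpha>"
  shows "dirichlet_norm p \<alpha> f =
           (norm (f 0) powr p + weighted_integral p \<alpha> (deriv f) / pi) powr (1 / p)"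
  using assms
  by (simp add: dirichlet_space_iff dirichlet_norm_def dirichlet_integrand_def[abs_def] set_integral_area_measure)

lemma weighted_integral_nonneg: "0 \<le> weighted_integral p \<alpha> h"
  by (rule set_integral_nonneg) simp

lemma weighted_integrand_cong:
  assumes "\<And>z. z \<in> ball 0 1 \<Longrightarrow> h z = k z"
  shows "set_integrable lborel (ball 0 1) (weighted_integrand p \<alpha> h) \<longleftrightarrow>
           set_integrable lborel (ball 0 1) (weighted_integrand p \<alpha> k)"
    and "weighted_integral p \<alpha> h = weighted_integral p \<alpha> k"
proof -
  show "set_integrable lborel (ball 0 1) (weighted_integrand p \<alpha> h) \<longleftrightarrow>
           set_integrable lborel (ball 0 1) (weighted_integrand p \<alpha> k)"
    by (rule set_integrable_cong) (use assms in auto)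
  show "weighted_integral p \<alpha> h = weighted_integral p \<alpha> k"
    by (rule set_lebesgue_integral_cong) (use assms in auto)
qed

section \<open>Radial primitives and the reduction to multiplication by g\<close>

lemma has_field_derivative_radial_integral:
  assumes hol: "k holomorphic_on ball 0 1" and z: "z \<in> ball 0 1"
  shows "((\<lambda>z. contour_integral (linepath 0 z) k) has_field_derivative k z) (at z)"
proof -
  obtain F where F: "\<And>x. x \<in> ball 0 1 \<Longrightarrow> (F has_field_derivative k x) (at x within ball 0 1)"
    using holomorphic_convex_primitive'[OF convex_ball open_ball hol] by blast
  \<comment> \<open>The segment from 0 to w stays in the convex disc, so the radial integral agrees
    with a primitive throughout a neighbourhood of z.\<close>
  have eq: "contour_integral (linepath 0 w) k = F w - F 0" if "w \<in> ball 0 1" for w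
  proof -
    have "path_image (linepath 0 w) \<subseteq> ball 0 1"
      using that closed_segment_subset[of 0 "ball 0 1" w] by simp
    then show ?thesis
      using contour_integral_primitive[OF F valid_path_linepath] by (simp add: contour_integral_unique)
  qed
  have "((\<lambda>w. F w - F 0) has_field_derivative k z) (at z)"
    using F[OF z] at_within_open[OF z open_ball] by (auto intro!: derivative_eq_intros)
  then show ?thesis
    by (rule DERIV_cong_ev[THEN iffD1, rotated -1])
      (use z eq in \<open>auto intro!: eventually_nhds_in_open[THEN eventually_mono, of "ball 0 1"]\<close>)
qed

lemma S_op_properties:
  assumes f: "f holomorphic_on ball 0 1" and g: "g holomorphic_on ball 0 1"
  shows "S_op g f holomorphic_on ball 0 1"
    and "\<And>z. z \<in> ball 0 1 \<Longrightarrow> deriv (S_op g f) z = deriv f z * g z"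
    and "S_op g f 0 = 0"
proof -
  have "(\<lambda>w. deriv f w * g w) holomorphic_on ball 0 1"
    using f g by (intro holomorphic_intros) auto
  then have *: "(S_op g f has_field_derivative deriv f z * g z) (at z)" if "z \<in> ball 0 1" for z
    using has_field_derivative_radial_integral[OF _ that] by (simp add: S_op_def[abs_def])
  then show "S_op g f holomorphic_on ball 0 1"
    unfolding holomorphic_on_open[OF open_ball] by blast
  show "\<And>z. z \<in> ball 0 1 \<Longrightarrow> deriv (S_op g f) z = deriv f z * g z"
    using * by (rule DERIV_imp_deriv)
  show "S_op g f 0 = 0"
    by (simp add: S_op_def)
qed

text \<open>Every holomorphic \<open>h\<close> is the derivative of its radial primitive, which
  vanishes at 0, and \<open>S_op g f\<close> vanishes at 0 as well. So |f(0)| matters only in the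
  second direction, where it merely enlarges the right-hand side.\<close>

lemma bounded_S_op_iff_multiplier:
  assumes g: "g holomorphic_on ball 0 1" and p: "0 < p" and q: "0 < q"
  shows "bounded_dirichlet_op p \<alpha> q \<beta> (S_op g) \<longleftrightarrow> (\<exists>K. weighted_multiplier_bound p \<alpha> q \<beta> g K)"
proof
  assume bdd: "bounded_dirichlet_op p \<alpha> q \<beta> (S_op g)"
  then obtain C where C: "\<And>f. f \<in> dirichlet_space p \<alpha> \<Longrightarrow>
      dirichlet_norm q \<beta> (S_op g f) \<le> C * dirichlet_norm p \<alpha> f"
    by (auto simp: bounded_dirichlet_op_def)
  \<comment> \<open>\<open>C\<close> comes without a sign, whereas the base of a real power should
    be nonnegative.\<close>
  define B where "B = max C 0"
  \<comment> \<open>The factor 1 / pi of the area measure occurs once on the left and to the power q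
    / p on the right.\<close>
  define K where "K = pi * B powr q / pi powr (q / p)"
  have "set_integrable lborel (ball 0 1) (weighted_integrand q \<beta> (\<lambda>z. h z * g z)) \<and>
        weighted_integral q \<beta> (\<lambda>z. h z * g z) \<le> K * weighted_integral p \<alpha> h powr (q / p)"
    if h: "h holomorphic_on ball 0 1"
      and int: "set_integrable lborel (ball 0 1) (weighted_integrand p \<alpha> h)" for h
  proof -
    define f where "f = (\<lambda>z. contour_integral (linepath 0 z) h)"
    have df: "(f has_field_derivative h z) (at z)" if "z \<in> ball 0 1" for z
      unfolding f_def by (rule has_field_derivative_radial_integral[OF h that])
    have f0: "f 0 = 0"
      by (simp add: f_def)
    have f: "f holomorphic_on ball 0 1"
      unfolding holomorphic_on_open[OF open_ball] using df by blast
    have deriv_f: "deriv f z = h z" if "z \<in> ball 0 1" for z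
      using df[OF that] by (rule DERIV_imp_deriv)
    have fD: "f \<in> dirichlet_space p \<alpha>"
      using f int weighted_integrand_cong(1)[OF deriv_f] by (simp add: dirichlet_space_iff)
    have eq: "deriv (S_op g f) z = h z * g z" if "z \<in> ball 0 1" for z
      using S_op_properties(2)[OF f g that] deriv_f[OF that] by simp
    have SD: "S_op g f \<in> dirichlet_space q \<beta>"
      using bdd fD by (auto simp: bounded_dirichlet_op_def)
    define I where "I = weighted_integral p \<alpha> h"
    define J where "J = weighted_integral q \<beta> (\<lambda>z. h z * g z)"
    have IJ: "0 \<le> I" "0 \<le> J"
      unfolding I_def J_def by (rule weighted_integral_nonneg)+
    have "(J / pi) powr (1 / q) = dirichlet_norm q \<beta> (S_op g f)"
      using dirichlet_norm_eq[OF SD] weighted_integrand_cong(2)[OF eq] S_op_properties(3)[OF f g]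
      by (simp add: J_def)
    also have "\<dots> \<le> C * dirichlet_norm p \<alpha> f"
      by (rule C[OF fD])
    also have "\<dots> \<le> B * dirichlet_norm p \<alpha> f"
      by (intro mult_right_mono) (simp_all add: B_def dirichlet_norm_def)
    also have "dirichlet_norm p \<alpha> f = (I / pi) powr (1 / p)"
      using dirichlet_norm_eq[OF fD] weighted_integrand_cong(2)[OF deriv_f] f0 by (simp add: I_def)
    finally have "((J / pi) powr (1 / q)) powr q \<le> (B * (I / pi) powr (1 / p)) powr q"
      using q by (intro powr_mono2) auto
    then have "J / pi \<le> B powr q * (I / pi) powr (q / p)"
      using q IJ by (simp add: powr_powr powr_mult B_def)
    then have "J \<le> K * I powr (q / p)"
      using IJ by (simp add: K_def powr_divide field_simps)
    moreover have "set_integrable lborel (ball 0 1) (weighted_integrand q \<beta> (\<lambda>z. h z * g z))"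
      using SD weighted_integrand_cong(1)[OF eq] by (simp add: dirichlet_space_iff)
    ultimately show ?thesis
      by (simp add: I_def J_def)
  qed
  then show "\<exists>K. weighted_multiplier_bound p \<alpha> q \<beta> g K"
    unfolding weighted_multiplier_bound_def by (intro exI[of _ K]) (simp add: K_def)
next
  assume "\<exists>K. weighted_multiplier_bound p \<alpha> q \<beta> g K"
  then obtain K where K: "K \<ge> 0" and mult: "\<And>h. \<lbrakk>h holomorphic_on ball 0 1;
        set_integrable lborel (ball 0 1) (weighted_integrand p \<alpha> h)\<rbrakk> \<Longrightarrow>
        set_integrable lborel (ball 0 1) (weighted_integrand q \<beta> (\<lambda>z. h z * g z)) \<and>
        weighted_integral q \<beta> (\<lambda>z. h z * g z) \<le> K * weighted_integral p \<alpha> h powr (q / p)"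
    by (auto simp: weighted_multiplier_bound_def)
  define C where "C = (K * pi powr (q / p) / pi) powr (1 / q)"
  have "S_op g f \<in> dirichlet_space q \<beta> \<and> dirichlet_norm q \<beta> (S_op g f) \<le> C * dirichlet_norm p \<alpha> f"
    if fD: "f \<in> dirichlet_space p \<alpha>" for f
  proof -
    have f: "f holomorphic_on ball 0 1"
      and int: "set_integrable lborel (ball 0 1) (weighted_integrand p \<alpha> (deriv f))"
      using fD by (auto simp: dirichlet_space_iff)
    define I where "I = weighted_integral p \<alpha> (deriv f)"
    define J where "J = weighted_integral q \<beta> (\<lambda>z. deriv f z * g z)"
    have IJ: "0 \<le> I" "0 \<le> J"
      unfolding I_def J_def by (rule weighted_integral_nonneg)+
    have *: "set_integrable lborel (ball 0 1) (weighted_integrand q \<beta> (\<lambda>z. deriv f z * g z))"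
      "J \<le> K * I powr (q / p)"
      using mult[OF holomorphic_deriv[OF f open_ball] int] by (auto simp: I_def J_def)
    have eq: "deriv (S_op g f) z = deriv f z * g z" if "z \<in> ball 0 1" for z
      by (rule S_op_properties(2)[OF f g that])
    have SD: "S_op g f \<in> dirichlet_space q \<beta>"
      using *(1) S_op_properties(1)[OF f g] weighted_integrand_cong(1)[OF eq] by (simp add: dirichlet_space_iff)
    have "dirichlet_norm q \<beta> (S_op g f) = (J / pi) powr (1 / q)"
      using dirichlet_norm_eq[OF SD] weighted_integrand_cong(2)[OF eq] S_op_properties(3)[OF f g]
      by (simp add: J_def)
    also have "\<dots> \<le> (K * I powr (q / p) / pi) powr (1 / q)"
      using *(2) IJ q by (intro powr_mono2 divide_right_mono) auto
    also have "K * I powr (q / p) / pi = (K * pi powr (q / p) / pi) * (I / pi) powr (q / p)"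
      using IJ by (simp add: powr_divide)
    also have "\<dots> powr (1 / q) = C * (I / pi) powr (1 / p)"
      unfolding C_def powr_mult[of "K * pi powr (q / p) / pi"] powr_powr using q by simp
    \<comment> \<open>Here the term |f(0)|^p is added back.\<close>
    also have "\<dots> \<le> C * dirichlet_norm p \<alpha> f"
      unfolding dirichlet_norm_eq[OF fD] I_def[symmetric] using IJ p
      by (intro mult_left_mono powr_mono2) (auto simp: C_def)
    finally show ?thesis
      using SD by simp
  qed
  then show "bounded_dirichlet_op p \<alpha> q \<beta> (S_op g)"
    unfolding bounded_dirichlet_op_def by blast
qed

section \<open>Multiplier bounds and the growth of g\<close>

lemma multiplier_bound_imp_growth:
  assumes \<alpha>: "\<alpha> > -1" and p: "0 < p" and q: "0 < q" and g: "g holomorphic_on ball 0 1"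
    and bound: "weighted_multiplier_bound p \<alpha> q \<beta> g K"
  obtains M where "\<And>z. z \<in> ball 0 1 \<Longrightarrow> norm (g z) \<le> M * (1 - (norm z)\<^sup>2) powr ((2 + \<alpha>) / p - (2 + \<beta>) / q)"
proof -
  obtain C where C: "C > 0" and pt: "\<And>h z. \<lbrakk>h holomorphic_on ball 0 1;
        set_integrable lborel (ball 0 1) (weighted_integrand q \<beta> h); z \<in> ball 0 1\<rbrakk> \<Longrightarrow>
      norm (h z) powr q * (1 - (norm z)\<^sup>2) powr (2 + \<beta>) \<le> C * weighted_integral q \<beta> h"
    using weighted_point_estimate[OF q, of \<beta>] by blast
  \<comment> \<open>The common weighted integral of all test functions; its independence of the
    point \<open>a\<close> makes the constant \<open>B\<close> uniform.\<close>
  define W where "W = (LINT z:ball (0::complex) 1|lborel. (1 - (norm z)\<^sup>2) powr \<alpha>)"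
  define B where "B = C * (K * W powr (q / p))"
  have "norm (g a) \<le> B powr (1 / q) * (1 - (norm a)\<^sup>2) powr ((2 + \<alpha>) / p - (2 + \<beta>) / q)"
    if a: "a \<in> ball 0 1" for a
  proof -
    obtain h where h: "h holomorphic_on ball 0 1"
      "set_integrable lborel (ball 0 1) (weighted_integrand p \<alpha> h)"
      "weighted_integral p \<alpha> h = W" "norm (h a) = (1 - (norm a)\<^sup>2) powr (- ((2 + \<alpha>) / p))"
      using exists_test_function[OF \<alpha> p a] unfolding W_def by blast
    have hg: "set_integrable lborel (ball 0 1) (weighted_integrand q \<beta> (\<lambda>z. h z * g z))"
      "weighted_integral q \<beta> (\<lambda>z. h z * g z) \<le> K * W powr (q / p)"
      using bound h unfolding weighted_multiplier_bound_def by auto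
    define d where "d = 1 - (norm a)\<^sup>2"
    have d: "d > 0"
      using a by (simp add: d_def abs_square_less_1)
    define e where "e = (2 + \<alpha>) / p - (2 + \<beta>) / q"
    have "norm (h a * g a) powr q * d powr (2 + \<beta>) \<le> C * weighted_integral q \<beta> (\<lambda>z. h z * g z)"
      using pt[OF holomorphic_on_mult[OF h(1) g] hg(1) a] by (simp add: d_def)
    also have "\<dots> \<le> B"
      unfolding B_def using hg(2) C by (intro mult_left_mono) auto
    finally have "(norm (h a * g a) powr q * d powr (2 + \<beta>)) powr (1 / q) \<le> B powr (1 / q)"
      using q by (intro powr_mono2) auto
    also have "(norm (h a * g a) powr q * d powr (2 + \<beta>)) powr (1 / q) = norm (h a * g a) * d powr ((2 + \<beta>) / q)"
      using q d by (simp add: powr_mult powr_powr)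
    also have "\<dots> = norm (g a) * d powr (- e)"
      using d by (simp add: norm_mult h(4) d_def[symmetric] e_def powr_add[symmetric] mult.assoc mult.left_commute)
    finally have "norm (g a) * d powr (- e) * d powr e \<le> B powr (1 / q) * d powr e"
      by (rule mult_right_mono) simp
    then show ?thesis
      using d by (simp add: mult.assoc powr_add[symmetric] d_def e_def)
  qed
  then show ?thesis
    by (rule that)
qed

lemma growth_imp_multiplier_bound:
  fixes \<alpha> \<beta> p q M :: real
  assumes p: "0 < p" and pq: "p < q" and g: "g holomorphic_on ball 0 1" and M: "M \<ge> 0"
    and growth: "\<And>z. z \<in> ball 0 1 \<Longrightarrow> norm (g z) \<le> M * (1 - (norm z)\<^sup>2) powr ((2 + \<alpha>) / p - (2 + \<beta>) / q)"
  shows "\<exists>K. weighted_multiplier_bound p \<alpha> q \<beta> g K"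
proof -
  obtain C where C: "C > 0" and pt: "\<And>h z. \<lbrakk>h holomorphic_on ball 0 1;
        set_integrable lborel (ball 0 1) (weighted_integrand p \<alpha> h); z \<in> ball 0 1\<rbrakk> \<Longrightarrow>
      norm (h z) powr p * (1 - (norm z)\<^sup>2) powr (2 + \<alpha>) \<le> C * weighted_integral p \<alpha> h"
    using weighted_point_estimate[OF p, of \<alpha>] by blast
  \<comment> \<open>The point estimate bounds |h|^p, so |h|^(q - p) is its power with exponent s; p
    < q makes s positive, which preserves the inequality.\<close>
  define s where "s = (q - p) / p"
  have q: "q > 0" and s: "s > 0"
    using p pq by (auto simp: s_def)
  define K where "K = M powr q * C powr s"
  have "set_integrable lborel (ball 0 1) (weighted_integrand q \<beta> (\<lambda>z. h z * g z)) \<and>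
        weighted_integral q \<beta> (\<lambda>z. h z * g z) \<le> K * weighted_integral p \<alpha> h powr (q / p)"
    if h: "h holomorphic_on ball 0 1"
      and int: "set_integrable lborel (ball 0 1) (weighted_integrand p \<alpha> h)" for h
  proof -
    define I where "I = weighted_integral p \<alpha> h"
    have I: "I \<ge> 0"
      unfolding I_def by (rule weighted_integral_nonneg)
    have le: "weighted_integrand q \<beta> (\<lambda>z. h z * g z) z \<le> K * I powr s * weighted_integrand p \<alpha> h z"
      if z: "z \<in> ball 0 1" for z
    proof -
      define d where "d = 1 - (norm z)\<^sup>2"
      define x where "x = norm (h z)"
      define e where "e = (2 + \<alpha>) / p - (2 + \<beta>) / q"
      have d: "d > 0"
        using z by (simp add: d_def abs_square_less_1)
      have x: "x \<ge> 0"
        by (simp add: x_def)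
      have "x powr p * d powr (2 + \<alpha>) \<le> C * I"
        using pt[OF h int z] by (simp add: x_def d_def I_def)
      then have "(x powr p * d powr (2 + \<alpha>)) powr s \<le> (C * I) powr s"
        using s by (intro powr_mono2) auto
      then have *: "x powr (p * s) * d powr ((2 + \<alpha>) * s) \<le> C powr s * I powr s"
        using x d C I by (simp add: powr_mult powr_powr)
      have "norm (g z) powr q \<le> (M * d powr e) powr q"
        using growth[OF z] q by (intro powr_mono2) (auto simp: d_def e_def)
      also have "\<dots> = M powr q * d powr (e * q)"
        using M by (simp add: powr_mult powr_powr)
      finally have gq: "norm (g z) powr q \<le> M powr q * d powr (e * q)" .
      \<comment> \<open>The second identity is where the growth exponent is forced: the powers of 1
        - |z|^2 from |g|^q and the target weight are exactly those used up by the point estimate,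
        with the source weight \<alpha> left over.\<close>
      have exps: "q = p + p * s" "e * q + \<beta> = (2 + \<alpha>) * s + \<alpha>"
        using p q by (auto simp: s_def e_def field_simps)
      have "weighted_integrand q \<beta> (\<lambda>z. h z * g z) z = x powr q * norm (g z) powr q * d powr \<beta>"
        by (simp add: norm_mult powr_mult x_def d_def)
      also have "\<dots> \<le> x powr q * (M powr q * d powr (e * q)) * d powr \<beta>"
        using gq by (intro mult_right_mono mult_left_mono) auto
      also have "\<dots> = M powr q * x powr q * d powr (e * q + \<beta>)"
        by (simp add: powr_add)
      also have "x powr q = x powr p * x powr (p * s)"
        by (subst exps(1)) (rule powr_add)
      also have "M powr q * (x powr p * x powr (p * s)) * d powr (e * q + \<beta>) =
          M powr q * (x powr (p * s) * d powr ((2 + \<alpha>) * s)) * (x powr p * d powr \<alpha>)"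
        by (simp add: exps(2) powr_add)
      also have "\<dots> \<le> M powr q * (C powr s * I powr s) * (x powr p * d powr \<alpha>)"
        using * by (intro mult_right_mono mult_left_mono) auto
      finally show ?thesis
        by (simp add: K_def x_def d_def mult_ac)
    qed
    have int': "set_integrable lborel (ball 0 1) (\<lambda>z. K * I powr s * weighted_integrand p \<alpha> h z)"
      using int by simp
    have cont: "continuous_on (ball 0 1) (weighted_integrand q \<beta> (\<lambda>z. h z * g z))"
      using holomorphic_on_imp_continuous_on[OF h] holomorphic_on_imp_continuous_on[OF g] q
      by (intro continuous_on_mult continuous_on_powr' continuous_on_norm continuous_on_diff
          continuous_on_power continuous_on_const continuous_on_id) (auto simp: abs_square_eq_1 abs_square_le_1)
    \<comment> \<open>Domination yields integrability only for a measurable function, hence the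
      detour through continuity.\<close>
    have "(\<lambda>z. indicator (ball 0 1) z *\<^sub>R weighted_integrand q \<beta> (\<lambda>z. h z * g z) z) \<in> borel_measurable borel"
      by (rule borel_measurable_continuous_on_indicator[OF _ cont]) simp
    then have "set_borel_measurable lborel (ball 0 1) (weighted_integrand q \<beta> (\<lambda>z. h z * g z))"
      by (simp add: set_borel_measurable_def)
    then have hg: "set_integrable lborel (ball 0 1) (weighted_integrand q \<beta> (\<lambda>z. h z * g z))"
      by (rule set_integrable_bound[OF int']) (use le in \<open>auto intro!: AE_I2 order_trans[OF _ abs_ge_self]\<close>)
    have "weighted_integral q \<beta> (\<lambda>z. h z * g z) \<le> (LINT z:ball 0 1|lborel. K * I powr s * weighted_integrand p \<alpha> h z)"
      by (intro set_integral_mono hg int' le)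
    also have "\<dots> = K * (I powr s * I)"
      by (simp add: I_def mult.assoc)
    also have "I powr s * I = I powr (q / p)"
      using I p by (cases "I = 0") (simp_all add: s_def diff_divide_distrib powr_diff)
    finally show ?thesis
      using hg by (simp add: I_def)
  qed
  then show ?thesis
    unfolding weighted_multiplier_bound_def
    by (intro exI[of _ K]) (simp add: K_def)
qed

text \<open>The filter sees only a ring next to the unit circle. On the remaining closed disc the
  quotient of |g| by the positive weight is continuous, hence bounded, so the estimate extends
  inward with a larger constant.\<close>

lemma bigo_to_unit_circle_iff:
  assumes g: "g holomorphic_on ball 0 1"
  shows "(\<lambda>z. norm (g z)) \<in> O[to_unit_circle](\<lambda>z. (1 - (norm z)\<^sup>2) powr e) \<longleftrightarrow>
         (\<exists>M\<ge>0. \<forall>z\<in>ball 0 1. norm (g z) \<le> M * (1 - (norm z)\<^sup>2) powr e)"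
proof
  assume "(\<lambda>z. norm (g z)) \<in> O[to_unit_circle](\<lambda>z. (1 - (norm z)\<^sup>2) powr e)"
  then obtain c where c: "c > 0"
    and ev: "\<forall>\<^sub>F z in to_unit_circle. norm (g z) \<le> c * (1 - (norm z)\<^sup>2) powr e"
    by (auto elim!: landau_o.bigE)
  then obtain b :: real where b: "b < 1"
    and bound: "\<And>z. b < norm z \<Longrightarrow> norm z < 1 \<Longrightarrow> norm (g z) \<le> c * (1 - (norm z)\<^sup>2) powr e"
    unfolding to_unit_circle_def eventually_filtercomap eventually_at_left_field by metis
  define u where "u = (\<lambda>z. norm (g z) / (1 - (norm z)\<^sup>2) powr e)"
  have pos: "(1 - (norm z)\<^sup>2) powr e > 0" if "norm z < 1" for z :: complex
    using that by (simp add: abs_square_eq_1)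
  \<comment> \<open>\<open>b\<close> may be negative; this closed disc is then empty and the ring is
    the whole disc.\<close>
  have sub: "cball 0 b \<subseteq> ball (0::complex) 1"
    using b by auto
  have "continuous_on (ball 0 1) u"
    unfolding u_def
    by (intro continuous_on_divide continuous_on_norm holomorphic_on_imp_continuous_on[OF g] continuous_on_powr
        continuous_on_diff continuous_on_power continuous_on_const continuous_on_id)
      (auto simp: abs_square_eq_1)
  then have "bounded (u ` cball 0 b)"
    by (intro compact_imp_bounded compact_continuous_image compact_cball continuous_on_subset[OF _ sub])
  then obtain B where B: "\<And>z. z \<in> cball 0 b \<Longrightarrow> \<bar>u z\<bar> \<le> B"
    unfolding bounded_iff by (metis imageI real_norm_def)
  have "norm (g z) \<le> max c B * (1 - (norm z)\<^sup>2) powr e" if z: "z \<in> ball 0 1" for z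
  proof (cases "b < norm z")
    case True
    then have "norm (g z) \<le> c * (1 - (norm z)\<^sup>2) powr e"
      using bound z by simp
    also have "\<dots> \<le> max c B * (1 - (norm z)\<^sup>2) powr e"
      by (intro mult_right_mono) auto
    finally show ?thesis .
  next
    case False
    then have "u z \<le> max c B"
      using B[of z] by auto
    then show ?thesis
      using pos[of z] z by (simp add: u_def pos_divide_le_eq)
  qed
  then show "\<exists>M\<ge>0. \<forall>z\<in>ball 0 1. norm (g z) \<le> M * (1 - (norm z)\<^sup>2) powr e"
    using c by (intro exI[of _ "max c B"]) auto
next
  assume "\<exists>M\<ge>0. \<forall>z\<in>ball 0 1. norm (g z) \<le> M * (1 - (norm z)\<^sup>2) powr e"
  then obtain M where M: "\<forall>z\<in>ball 0 1. norm (g z) \<le> M * (1 - (norm z)\<^sup>2) powr e"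
    by blast
  have "\<forall>\<^sub>F r in at_left (1::real). r < 1"
    by (auto simp: eventually_at_filter)
  then have "\<forall>\<^sub>F z :: complex in to_unit_circle. norm z < 1"
    unfolding to_unit_circle_def by (rule eventually_filtercomapI)
  then have "\<forall>\<^sub>F z in to_unit_circle. norm (norm (g z)) \<le> M * norm ((1 - (norm z)\<^sup>2) powr e)"
    by eventually_elim (use M in auto)
  then show "(\<lambda>z. norm (g z)) \<in> O[to_unit_circle](\<lambda>z. (1 - (norm z)\<^sup>2) powr e)"
    by (rule bigoI)
qed

theorem theorem3:
  fixes \<alpha> \<beta> p q :: real and g :: "complex \<Rightarrow> complex"
  assumes "\<alpha> > -1" and "\<beta> > -1"
    and "g holomorphic_on ball 0 1"
    and "0 < p" and "p < q"
  shows "bounded_dirichlet_op p \<alpha> q \<beta> (S_op g) \<longleftrightarrow>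
         (\<lambda>z. norm (g z)) \<in> O[to_unit_circle](\<lambda>z. (1 - (norm z)\<^sup>2) powr ((2 + \<alpha>) / p - (2 + \<beta>) / q))"
proof -
  let ?e = "(2 + \<alpha>) / p - (2 + \<beta>) / q"
  have q: "0 < q"
    using assms by simp
  have "(\<exists>K. weighted_multiplier_bound p \<alpha> q \<beta> g K) \<longleftrightarrow>
      (\<exists>M\<ge>0. \<forall>z\<in>ball 0 1. norm (g z) \<le> M * (1 - (norm z)\<^sup>2) powr ?e)"
  proof
    assume "\<exists>K. weighted_multiplier_bound p \<alpha> q \<beta> g K"
    then obtain M where M: "\<And>z. z \<in> ball 0 1 \<Longrightarrow> norm (g z) \<le> M * (1 - (norm z)\<^sup>2) powr ?e"
      using multiplier_bound_imp_growth[OF assms(1) assms(4) q assms(3)] by metis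
    \<comment> \<open>At the origin the weight equals 1, so M \<ge> |g(0)|.\<close>
    moreover from M[of 0] have "M \<ge> 0"
      using order_trans[OF norm_ge_zero[of "g 0"]] by simp
    ultimately show "\<exists>M\<ge>0. \<forall>z\<in>ball 0 1. norm (g z) \<le> M * (1 - (norm z)\<^sup>2) powr ?e"
      by blast
  next
    assume "\<exists>M\<ge>0. \<forall>z\<in>ball 0 1. norm (g z) \<le> M * (1 - (norm z)\<^sup>2) powr ?e"
    then show "\<exists>K. weighted_multiplier_bound p \<alpha> q \<beta> g K"
      using growth_imp_multiplier_bound[OF assms(4,5,3)] by blast
  qed
  then show ?thesis
    unfolding bounded_S_op_iff_multiplier[OF assms(3,4) q] bigo_to_unit_circle_iff[OF assms(3)] .
qed

end
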